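(* If all agents $i\in[n]$ have XOS valuation functions (normalized so that $\mathrm{MMS}_i=1$), then for sufficiently large $n$, the Random Bundle Allocation algorithm is $\left(\frac{1}{4\log n},\,1-O\!\left(\frac1{\log n}\right)\right)$-competitive: on every such instance, with probability at least $1-O(1/\log n)$, all agents $i\in[n]$ simultaneously receive a bundle $A_i$ with $v_i(A_i)\ge\frac1{4\log n}\mathrm{MMS}_i$.
   Context: Setting: $n$ agents arrive in order $1,\dots,n$; agent $i$ has a monotone valuation $v_i:2^{[m]}\to\mathbb{R}_+$ over $m$ indivisible goods, revealed upon arrival, when goods must be allocated to her irrevocably. Valuations are fixed by an oblivious adversary. $\mathrm{MMS}_i=\max_{(P_1,\dots,P_n)}\min_\ell v_i(P_\ell)$ over partitions of $[m]$ into $n$ bundles. $v$ is XOS if $v(S)=\max_k a_k(S)$ for a finite collection of nonnegative additive clauses $a_k$; a supporting clause of a set $G$ is a clause $a_k$ with $a_k(G)=v(G)$. Random Bundle Allocation algorithm: fix an arbitrary ordering $g_1,\dots,g_m$ of the goods; set $R_1=[m]$, $t=0$, $s=\lfloor\frac{\log n}{16}\rfloor$. For $i=1,\dots,n$: if some $e\in R_i$ has $v_i(\{e\})\ge\frac1{4\log n}$, allocate to $i$ the first good $e^*$ of $R_i$ in the fixed ordering with $v_i(\{e^*\})\ge\frac{1}{4\log n}$, set $R_{i+1}=R_i\setminus\{e^*\}$, $t\leftarrow t+1$ (special round). Otherwise, let $P^i_1,\dots,P^i_n$ be an MMS partition of $[m]$ for agent $i$ (fixed independently of the algorithm's randomness)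 and $K=\{k: v_i(P^i_k\cap R_i)\ge\frac12\}$. If $|K|<\frac{n-t}{2}$, report failure. Otherwise pick $k\in K$ uniformly at random, let $G=P^i_k\cap R_i$, order $G=(e_1,\dots,e_{|G|})$ by non-increasing value in a supporting additive clause of $G$ for $v_i$, and for each $j=1,\dots,\lfloor |G|/s\rfloor$ select independently one good $e_{ij}$ uniformly at random from $(e_{(j-1)s+1},\dots,e_{js})$. Allocate $A_i=\bigcup_j\{e_{ij}\}$ to agent $i$ and set $R_{i+1}=R_i\setminus A_i$. *)

theory Defs
  imports "HOL-Probability.Probability" "HOL-Library.Landau_Symbols"
begin

text \<open>
  Agents are the elements of \<open>{1..n}\<close> and goods are natural numbers; \<open>M\<close> is the set of goods.
  Set functions are total functions on \<open>nat set\<close>, of which only the values on subsets of \<open>M\<close>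
  matter.
\<close>

definition valuation :: "nat set \<Rightarrow> (nat set \<Rightarrow> real) \<Rightarrow> bool" where
  "valuation M v \<longleftrightarrow> (\<forall>S\<subseteq>M. 0 \<le> v S) \<and> mono_on (Pow M) v"

text \<open>
  \<open>xos M C v\<close>: the finite collection \<open>C\<close> of nonnegative additive clauses represents \<open>v\<close> as an XOS
  function. A clause is given by its values on single goods. The clauses are a parameter because
  supporting clauses refer to them.
\<close>

definition xos :: "nat set \<Rightarrow> (nat \<Rightarrow> real) set \<Rightarrow> (nat set \<Rightarrow> real) \<Rightarrow> bool" where
  "xos M C v \<longleftrightarrow> finite C \<and> C \<noteq> {} \<and> (\<forall>a\<in>C. \<forall>g\<in>M. 0 \<le> a g) \<and>
     (\<forall>S\<subseteq>M. v S = Max ((\<lambda>a. sum a S) ` C))"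

definition supporting_clause ::
    "(nat \<Rightarrow> real) set \<Rightarrow> (nat set \<Rightarrow> real) \<Rightarrow> nat set \<Rightarrow> (nat \<Rightarrow> real) \<Rightarrow> bool" where
  "supporting_clause C v G a \<longleftrightarrow> a \<in> C \<and> sum a G = v G"

definition supporting_order ::
    "(nat \<Rightarrow> real) set \<Rightarrow> (nat set \<Rightarrow> real) \<Rightarrow> nat set \<Rightarrow> nat list \<Rightarrow> bool" where
  "supporting_order C v G es \<longleftrightarrow> distinct es \<and> set es = G \<and>
     (\<exists>a. supporting_clause C v G a \<and> sorted_wrt (\<lambda>x y. a x \<ge> a y) es)"

text \<open>Bundles of a partition may be empty.\<close>

definition bundle_partition :: "nat \<Rightarrow> nat set \<Rightarrow> (nat \<Rightarrow> nat set) \<Rightarrow> bool" where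
  "bundle_partition n M P \<longleftrightarrow> disjoint_family_on P {1..n} \<and> (\<Union>k\<in>{1..n}. P k) = M"

definition MMS :: "nat \<Rightarrow> nat set \<Rightarrow> (nat set \<Rightarrow> real) \<Rightarrow> real" where
  "MMS n M v = Max {Min ((\<lambda>k. v (P k)) ` {1..n}) | P. bundle_partition n M P}"

definition mms_partition :: "nat \<Rightarrow> nat set \<Rightarrow> (nat set \<Rightarrow> real) \<Rightarrow> (nat \<Rightarrow> nat set) \<Rightarrow> bool" where
  "mms_partition n M v P \<longleftrightarrow>
     bundle_partition n M P \<and> Min ((\<lambda>k. v (P k)) ` {1..n}) = MMS n M v"

text \<open>
  The random selection from \<open>es = (e\<^sub>1, e\<^sub>2, \<dots>)\<close>: one good is drawn uniformly and independently from
  each of the \<open>\<lfloor>|es| / s\<rfloor>\<close> consecutive blocks of length \<open>s\<close>; a last incomplete block is ignored.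
  Blocks are indexed from 0, so block \<open>j\<close> is \<open>take s (drop (j * s) es)\<close>. For \<open>s = 0\<close> (small \<open>n\<close>)
  there are no blocks, since division by 0 gives 0.
\<close>

definition select_from_blocks :: "nat \<Rightarrow> nat list \<Rightarrow> nat set pmf" where
  "select_from_blocks s es =
     (let J = {..<length es div s}
      in map_pmf (\<lambda>e. e ` J) (Pi_pmf J 0 (\<lambda>j. pmf_of_set (set (take s (drop (j * s) es))))))"

text \<open>
  States are triples \<open>(R, t, A)\<close> of the remaining goods, the number of special rounds so far and
  the bundles allocated so far; reported failure is the missing mass of an \<open>spmf\<close>.
  Logarithms are natural.
  The choices that the algorithm leaves open are parameters: the ordering \<open>gs\<close> of the goods, the
  MMS partition \<open>P i\<close> of each agent \<open>i\<close>, and the rule \<open>\<sigma> i\<close> that orders a bundle \<open>G\<close> as \<open>\<sigma> i G\<close>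
  (by a supporting clause and a way of breaking ties).
\<close>

type_synonym rba_state = "nat set \<times> nat \<times> (nat \<Rightarrow> nat set)"

definition rba_round ::
    "nat \<Rightarrow> nat list \<Rightarrow> (nat \<Rightarrow> nat set \<Rightarrow> real) \<Rightarrow> (nat \<Rightarrow> nat \<Rightarrow> nat set) \<Rightarrow>
     (nat \<Rightarrow> nat set \<Rightarrow> nat list) \<Rightarrow> nat \<Rightarrow> rba_state \<Rightarrow> rba_state spmf" where
  "rba_round n gs v P \<sigma> i = (\<lambda>(R, t, A).
     case find (\<lambda>e. e \<in> R \<and> v i {e} \<ge> 1 / (4 * ln (real n))) gs of
       Some e \<Rightarrow> return_spmf (R - {e}, t + 1, A(i := {e}))
     | None \<Rightarrow>
         (let s = nat \<lfloor>ln (real n) / 16\<rfloor>;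
              K = {k \<in> {1..n}. v i (P i k \<inter> R) \<ge> 1 / 2}
          in if real (card K) < (real n - real t) / 2 then return_pmf None
             else bind_spmf (spmf_of_set K) (\<lambda>k.
                  map_spmf (\<lambda>S. (R - S, t, A(i := S)))
                    (spmf_of_pmf (select_from_blocks s (\<sigma> i (P i k \<inter> R)))))))"

text \<open>The state after the first \<open>i\<close> agents.\<close>

primrec rba_state_after ::
    "nat \<Rightarrow> nat list \<Rightarrow> (nat \<Rightarrow> nat set \<Rightarrow> real) \<Rightarrow> (nat \<Rightarrow> nat \<Rightarrow> nat set) \<Rightarrow>
     (nat \<Rightarrow> nat set \<Rightarrow> nat list) \<Rightarrow> nat \<Rightarrow> rba_state spmf" where
  "rba_state_after n gs v P \<sigma> 0 = return_spmf (set gs, 0, \<lambda>_. {})"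
| "rba_state_after n gs v P \<sigma> (Suc i) =
     bind_spmf (rba_state_after n gs v P \<sigma> i) (rba_round n gs v P \<sigma> (Suc i))"

definition random_bundle_allocation ::
    "nat \<Rightarrow> nat list \<Rightarrow> (nat \<Rightarrow> nat set \<Rightarrow> real) \<Rightarrow> (nat \<Rightarrow> nat \<Rightarrow> nat set) \<Rightarrow>
     (nat \<Rightarrow> nat set \<Rightarrow> nat list) \<Rightarrow> (nat \<Rightarrow> nat set) spmf" where
  "random_bundle_allocation n gs v P \<sigma> = map_spmf (\<lambda>(R, t, A). A) (rba_state_after n gs v P \<sigma> n)"

end

theory Submission
  imports Defs
begin

text \<open>
  If no failure is reported, every agent is served well: in a non-special round all remaining goods
  are small, and the good drawn from a block is worth at least the average of the next block.

  To bound the failure probability, compare with the deterministic baseline in which non-special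
  rounds remove nothing. The goods remaining in a run are always among those remaining in the
  baseline, and the run has at most as many special rounds. Hence both the number of special rounds
  and the set of goods they take deviate from the baseline by at most the number of goods of the
  final baseline set of special goods that were lost in non-special rounds. A non-special round
  loses each good with probability at most \<open>2 / (s (n - t))\<close>, so this number grows by at most
  \<open>2 / s\<close> per non-special round in expectation, and Markov's inequality controls it for all agents
  at once. For each single agent, the value lost in bundles that the baseline leaves untouched is
  controlled by an exponential moment, and these errors are summable over the agents. Both bounds are
  combined in one potential \<open>psi\<close>, which is a supermartingale, is at least 1 upon failure, and starts
  at \<open>O(1 / s)\<close>.
\<close>

subsection \<open>Random selection from blocks\<close>

lemma block_end_le:
  fixes j n s :: nat
  assumes "j < n div s"
  shows "j * s + s \<le> n"
proof -
  have "Suc j * s \<le> n div s * s" using assms by (intro mult_le_mono1) simp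
  then show ?thesis
    by (metis add.commute div_times_less_eq_dividend le_trans mult_Suc)
qed

lemma block_conv_nth:
  assumes "j * s + s \<le> length es"
  shows "set (take s (drop (j * s) es)) = (\<lambda>l. es ! (j * s + l)) ` {..<s}"
  using assms by (subst nth_image[symmetric]) (auto simp: image_iff atLeast0LessThan)

lemma sum_block_conv_nth:
  fixes w :: "'a \<Rightarrow> real"
  assumes "distinct es" "j * s + s \<le> length es"
  shows "sum w (set (take s (drop (j * s) es))) = (\<Sum>l<s. w (es ! (j * s + l)))"
  unfolding block_conv_nth[OF assms(2)] using assms
  by (subst sum.reindex) (auto intro!: inj_onI simp: nth_eq_iff_index_eq)

lemma sum_blocks_le:
  fixes w :: "'a \<Rightarrow> real"
  assumes "distinct es" "\<And>e. e \<in> set es \<Longrightarrow> 0 \<le> w e"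
  shows "(\<Sum>j<length es div s. sum w (set (take s (drop (j * s) es)))) \<le> sum w (set es)"
proof -
  have blk: "sum w (set (take s (drop (j * s) es))) = (\<Sum>i\<in>{j * s..<j * s + s}. w (es ! i))"
    if "j < length es div s" for j
    using sum_block_conv_nth[OF assms(1) block_end_le[OF that], of w]
      sum.shift_bounds_nat_ivl[of "\<lambda>i. w (es ! i)" 0 "j * s" s]
    by (simp add: add.commute atLeast0LessThan)
  have "(\<Sum>j<length es div s. sum w (set (take s (drop (j * s) es))))
      = (\<Sum>i<length es div s * s. w (es ! i))"
    using blk by (simp add: sum.nat_group[symmetric])
  also have "\<dots> \<le> (\<Sum>i<length es. w (es ! i))"
    using assms(2) by (intro sum_mono2) (auto intro: less_le_trans[OF _ div_times_less_eq_dividend])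
  also have "\<dots> = sum w (set es)"
    using assms(1) by (simp add: sum_list_distinct_conv_sum_set[symmetric] sum_list_sum_nth atLeast0LessThan)
  finally show ?thesis .
qed

context
  fixes s :: nat and es :: "nat list"
  assumes s: "0 < s" and es: "distinct es"
begin

lemma block_nonempty:
  assumes "j < length es div s"
  shows "set (take s (drop (j * s) es)) \<noteq> {}"
  using block_conv_nth[OF block_end_le[OF assms]] s by auto

lemma set_Pi_pmf_blocks:
  "set_pmf (Pi_pmf {..<length es div s} 0 (\<lambda>j. pmf_of_set (set (take s (drop (j * s) es)))))
    = PiE_dflt {..<length es div s} 0 (\<lambda>j. set (take s (drop (j * s) es)))"
  using set_pmf_of_set[OF block_nonempty List.finite_set]
  by (subst set_Pi_pmf) (auto simp: PiE_dflt_def)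

lemma finite_set_select_from_blocks: "finite (set_pmf (select_from_blocks s es))"
  unfolding select_from_blocks_def Let_def set_map_pmf set_Pi_pmf_blocks
  by (intro finite_imageI finite_PiE_dflt) auto

lemma set_select_from_blocks:
  assumes "S \<in> set_pmf (select_from_blocks s es)"
  obtains e where "S = e ` {..<length es div s}"
    "\<And>j. j < length es div s \<Longrightarrow> e j \<in> set (take s (drop (j * s) es))"
proof -
  from assms obtain e where "S = e ` {..<length es div s}"
    "e \<in> PiE_dflt {..<length es div s} 0 (\<lambda>j. set (take s (drop (j * s) es)))"
    unfolding select_from_blocks_def Let_def set_map_pmf set_Pi_pmf_blocks by blast
  then show thesis by (intro that) (auto simp: PiE_dflt_def)
qed

lemma select_from_blocks_subset:
  assumes "S \<in> set_pmf (select_from_blocks s es)"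
  shows "S \<subseteq> set es"
  using set_select_from_blocks[OF assms] by (metis image_subset_iff in_set_dropD in_set_takeD lessThan_iff)

lemma expectation_block:
  fixes f :: "nat \<Rightarrow> real"
  assumes "j < length es div s"
  shows "measure_pmf.expectation (pmf_of_set (set (take s (drop (j * s) es)))) f
    = sum f (set (take s (drop (j * s) es))) / s"
proof -
  have "card (set (take s (drop (j * s) es))) = s"
    using block_end_le[OF assms] es by (simp add: distinct_card)
  then show ?thesis
    using block_nonempty[OF assms] by (simp add: integral_pmf_of_set)
qed

text \<open>Linearity of expectation: a good is drawn with probability \<open>1 / s\<close> if it
  lies in a complete block and never otherwise.\<close>

lemma expectation_sum_select_le:
  fixes w :: "nat \<Rightarrow> real"
  assumes w: "\<And>e. e \<in> set es \<Longrightarrow> 0 \<le> w e"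
  shows "measure_pmf.expectation (select_from_blocks s es) (sum w) \<le> sum w (set es) / s"
proof -
  define J where "J = {..<length es div s}"
  define b where "b j = set (take s (drop (j * s) es))" for j
  define D where "D = Pi_pmf J 0 (\<lambda>j. pmf_of_set (b j))"
  have fin: "finite (set_pmf D)" unfolding D_def J_def b_def
    unfolding set_Pi_pmf_blocks by (rule finite_PiE_dflt) auto
  have D: "e j \<in> b j" if "e \<in> set_pmf D" "j \<in> J" for e j
    using that unfolding D_def J_def b_def set_Pi_pmf_blocks by (auto simp: PiE_dflt_def)
  have bs: "b j \<subseteq> set es" for j unfolding b_def by (meson in_set_dropD in_set_takeD subsetI)
  have "measure_pmf.expectation (select_from_blocks s es) (sum w)
      = measure_pmf.expectation D (\<lambda>e. sum w (e ` J))"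
    unfolding select_from_blocks_def Let_def D_def J_def b_def by simp
  also have "\<dots> \<le> measure_pmf.expectation D (\<lambda>e. \<Sum>j\<in>J. w (e j))"
  proof (rule integral_mono_AE)
    \<comment> \<open>Coinciding draws could only lower the left side, so for an upper bound
      injectivity of \<open>e\<close> can be left open.\<close>
    have "sum w (e ` J) \<le> (\<Sum>j\<in>J. w (e j))" if "e \<in> set_pmf D" for e
      using subsetD[OF bs D[OF that]] w by (intro sum_image_le[unfolded o_def]) (auto simp: J_def)
    then show "AE e in D. sum w (e ` J) \<le> (\<Sum>j\<in>J. w (e j))"
      by (simp add: AE_measure_pmf_iff)
  qed (auto intro!: integrable_measure_pmf_finite fin)
  also have "\<dots> = (\<Sum>j\<in>J. measure_pmf.expectation D (\<lambda>e. w (e j)))"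
    by (rule Bochner_Integration.integral_sum) (auto intro!: integrable_measure_pmf_finite fin)
  also have "\<dots> = (\<Sum>j\<in>J. sum w (b j) / s)"
  proof (rule sum.cong)
    fix j assume j: "j \<in> J"
    have "measure_pmf.expectation D (\<lambda>e. w (e j)) = measure_pmf.expectation (map_pmf (\<lambda>e. e j) D) w" by simp
    also have "\<dots> = sum w (b j) / s"
      using j expectation_block[of j w] by (simp add: D_def Pi_pmf_component J_def b_def)
    finally show "measure_pmf.expectation D (\<lambda>e. w (e j)) = sum w (b j) / s" .
  qed simp
  also have "\<dots> \<le> sum w (set es) / s"
    using sum_blocks_le[OF es w, where s=s]
    by (simp add: sum_divide_distrib[symmetric] J_def b_def divide_right_mono)
  finally show ?thesis .
qed

text \<open>A Chernoff estimate. The draws are independent, so the moment factors over the blocks.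
  On the unit interval \<open>exp (l * x)\<close> lies below its chord, which bounds the factor of a
  block by the exponential of \<open>exp l - 1\<close> times the block average.\<close>

lemma expectation_exp_select_le:
  fixes w :: "nat \<Rightarrow> real"
  assumes w: "\<And>e. e \<in> set es \<Longrightarrow> 0 \<le> w e" "\<And>e. e \<in> set es \<Longrightarrow> w e \<le> 1" and l: "0 \<le> l"
  shows "measure_pmf.expectation (select_from_blocks s es) (\<lambda>S. exp (l * sum w S))
    \<le> exp ((exp l - 1) * sum w (set es) / s)"
proof -
  define J where "J = {..<length es div s}"
  define b where "b j = set (take s (drop (j * s) es))" for j
  define D where "D = Pi_pmf J 0 (\<lambda>j. pmf_of_set (b j))"
  have fin: "finite (set_pmf D)" unfolding D_def J_def b_def
    unfolding set_Pi_pmf_blocks by (rule finite_PiE_dflt) auto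
  have D: "e j \<in> b j" if "e \<in> set_pmf D" "j \<in> J" for e j
    using that unfolding D_def J_def b_def set_Pi_pmf_blocks by (auto simp: PiE_dflt_def)
  have bs: "b j \<subseteq> set es" for j unfolding b_def by (meson in_set_dropD in_set_takeD subsetI)
  have chord: "exp (l * x) \<le> 1 + (exp l - 1) * x" if "0 \<le> x" "x \<le> 1" for x
    using convex_onD[OF exp_convex, of x 0 l] that by (simp add: algebra_simps)
  have "measure_pmf.expectation (select_from_blocks s es) (\<lambda>S. exp (l * sum w S))
      = measure_pmf.expectation D (\<lambda>e. exp (l * sum w (e ` J)))"
    unfolding select_from_blocks_def Let_def D_def J_def b_def by simp
  also have "\<dots> \<le> measure_pmf.expectation D (\<lambda>e. \<Prod>j\<in>J. exp (l * w (e j)))"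
  proof (rule integral_mono_AE)
    have "sum w (e ` J) \<le> (\<Sum>j\<in>J. w (e j))" if "e \<in> set_pmf D" for e
      using subsetD[OF bs D[OF that]] w by (intro sum_image_le[unfolded o_def]) (auto simp: J_def)
    then show "AE e in D. exp (l * sum w (e ` J)) \<le> (\<Prod>j\<in>J. exp (l * w (e j)))"
      using l by (auto simp: AE_measure_pmf_iff J_def exp_sum[symmetric] sum_distrib_left[symmetric]
        intro!: mult_left_mono)
  qed (auto intro!: integrable_measure_pmf_finite fin)
  also have "\<dots> = (\<Prod>j\<in>J. measure_pmf.expectation (pmf_of_set (b j)) (\<lambda>x. exp (l * w x)))"
    unfolding D_def
    by (rule expectation_prod_Pi_pmf) (auto simp: J_def b_def set_pmf_of_set[OF block_nonempty] intro!: integrable_measure_pmf_finite)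
  also have "\<dots> \<le> (\<Prod>j\<in>J. exp ((exp l - 1) * sum w (b j) / s))"
  proof (intro prod_mono conjI)
    fix j assume j: "j \<in> J"
    have "(\<Sum>x\<in>b j. exp (l * w x)) \<le> (\<Sum>x\<in>b j. 1 + (exp l - 1) * w x)"
      using w bs[of j] by (intro sum_mono chord) auto
    also have "\<dots> = s + (exp l - 1) * sum w (b j)"
      using block_end_le[of j "length es" s] es j
      by (simp add: sum.distrib sum_distrib_left b_def J_def distinct_card)
    finally have "(\<Sum>x\<in>b j. exp (l * w x)) / s \<le> 1 + (exp l - 1) * sum w (b j) / s"
      using s by (simp add: field_simps)
    also have "\<dots> \<le> exp ((exp l - 1) * sum w (b j) / s)" by (rule exp_ge_add_one_self)
    finally show "measure_pmf.expectation (pmf_of_set (b j)) (\<lambda>x. exp (l * w x))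
      \<le> exp ((exp l - 1) * sum w (b j) / s)"
      using j expectation_block[of j] by (simp add: J_def b_def)
  qed simp
  also have "\<dots> = exp ((exp l - 1) * (\<Sum>j\<in>J. sum w (b j)) / s)"
    by (simp add: exp_sum[symmetric] J_def sum_distrib_left sum_divide_distrib)
  also have "\<dots> \<le> exp ((exp l - 1) * sum w (set es) / s)"
    using sum_blocks_le[OF es w(1), where s=s] l
    by (auto simp: J_def b_def intro!: divide_right_mono mult_left_mono)
  finally show ?thesis .
qed

text \<open>The order is non-increasing, so a draw is worth at least as much as any good of the
  following block, and \<open>s\<close> times its value covers that block. Only the first block has
  no predecessor; it is worth at most \<open>s * c\<close>.\<close>

lemma select_from_blocks_value:
  fixes a :: "nat \<Rightarrow> real" and c :: real
  assumes S: "S \<in> set_pmf (select_from_blocks s es)"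
    and a: "\<And>e. e \<in> set es \<Longrightarrow> 0 \<le> a e" "\<And>e. e \<in> set es \<Longrightarrow> a e \<le> c"
    and srt: "sorted_wrt (\<lambda>x y. a x \<ge> a y) es" and c: "0 \<le> c"
  shows "sum a (set es) - s * c \<le> s * sum a S"
proof -
  define J where "J = length es div s"
  from set_select_from_blocks[OF S] obtain e where e: "S = e ` {..<J}"
    "\<And>j. j < J \<Longrightarrow> e j \<in> set (take s (drop (j * s) es))" unfolding J_def by metis
  \<comment> \<open>Padding with zeros turns the incomplete tail into a full block, covered by the
    draw from the last complete block.\<close>
  define b where "b i = (if i < length es then a (es ! i) else 0)" for i
  have "\<exists>l<s. e j = es ! (j * s + l)" if "j < J" for j
    using e(2)[OF that] block_conv_nth[OF block_end_le[of j "length es" s]] that by (auto simp: J_def)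
  then obtain p where p: "\<And>j. j < J \<Longrightarrow> p j < s" "\<And>j. j < J \<Longrightarrow> e j = es ! (j * s + p j)" by metis
  have lt: "j * s + p j < length es" if "j < J" for j
    using block_end_le[of j "length es" s] p(1)[OF that] that by (simp add: J_def)
  \<comment> \<open>For this lower bound on \<open>sum a S\<close> a collision would be harmful;
    draws from different blocks sit at different positions of a distinct list.\<close>
  have inj: "inj_on e {..<J}"
  proof (rule inj_onI)
    fix i j assume ij: "i \<in> {..<J}" "j \<in> {..<J}" "e i = e j"
    then have "i * s + p i = j * s + p j"
      using lt p(2) es by (simp add: nth_eq_iff_index_eq)
    then have "(i * s + p i) div s = (j * s + p j) div s" by simp
    then show "i = j" using p(1)[of i] p(1)[of j] ij by simp
  qed
  have b0: "0 \<le> b i" for i using a(1) by (simp add: b_def)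
  have step: "(\<Sum>i\<in>{j * s + s..<j * s + s + s}. b i) \<le> s * a (e j)" if j: "j < J" for j
  proof -
    have "b i \<le> a (e j)" if "i \<in> {j * s + s..<j * s + s + s}" for i
      using that sorted_wrt_nth_less[OF srt, of "j * s + p j" i] p[OF j] a(1) lt[OF j]
      by (auto simp: b_def)
    then have "(\<Sum>i\<in>{j * s + s..<j * s + s + s}. b i) \<le> (\<Sum>i\<in>{j * s + s..<j * s + s + s}. a (e j))"
      by (intro sum_mono) auto
    then show ?thesis by simp
  qed
  have "sum a (set es) = (\<Sum>i<length es. b i)"
    using es by (simp add: sum_list_distinct_conv_sum_set[symmetric] sum_list_sum_nth atLeast0LessThan b_def)
  also have "\<dots> \<le> (\<Sum>i<s + J * s. b i)"
  proof (rule sum_mono2)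
    have "length es < s + J * s" using s dividend_less_div_times[of s "length es"] by (simp add: J_def)
    then show "{..<length es} \<subseteq> {..<s + J * s}" by auto
  qed (use b0 in auto)
  also have "\<dots> = (\<Sum>i<s. b i) + (\<Sum>i\<in>{s..<s + J * s}. b i)"
    by (subst sum.union_disjoint[symmetric]) (auto simp: ivl_disj_un)
  also have "(\<Sum>i\<in>{s..<s + J * s}. b i) = (\<Sum>i<J * s. b (i + s))"
    using sum.shift_bounds_nat_ivl[of b 0 s "J * s"] by (simp add: atLeast0LessThan add.commute)
  also have "\<dots> = (\<Sum>j<J. \<Sum>i\<in>{j * s..<j * s + s}. b (i + s))" by (rule sum.nat_group[symmetric])
  also have "\<dots> = (\<Sum>j<J. \<Sum>i\<in>{j * s + s..<j * s + s + s}. b i)"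
    by (intro sum.cong refl sum.shift_bounds_nat_ivl[symmetric])
  also have "\<dots> \<le> (\<Sum>j<J. s * a (e j))" by (intro sum_mono step) auto
  also have "\<dots> = s * sum a S" unfolding e(1) using inj by (simp add: sum.reindex sum_distrib_left)
  finally have "sum a (set es) \<le> (\<Sum>i<s. b i) + s * sum a S" by simp
  moreover have "(\<Sum>i<s. b i) \<le> (\<Sum>i<s. c)" using a(2) c by (intro sum_mono) (auto simp: b_def)
  ultimately show ?thesis by simp
qed

end

subsection \<open>XOS valuations and bundle weights\<close>

lemma xos_valuation_clause:
  assumes "xos M C v" "S \<subseteq> M"
  obtains a where "a \<in> C" "sum a S = v S"
proof -
  have "Max ((\<lambda>a. sum a S) ` C) \<in> (\<lambda>a. sum a S) ` C"
    using assms(1) by (intro Max_in) (auto simp: xos_def)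
  moreover have "v S = Max ((\<lambda>a. sum a S) ` C)" using assms by (simp add: xos_def)
  ultimately show thesis using that by auto
qed

lemma xos_clause_le:
  assumes "xos M C v" "S \<subseteq> M" "a \<in> C"
  shows "sum a S \<le> v S"
proof -
  have "v S = Max ((\<lambda>a. sum a S) ` C)" "finite C" using assms by (simp_all add: xos_def)
  then show ?thesis using assms(3) by simp
qed

text \<open>A representative in \<open>B\<close> of each touched set gives an injection into
  \<open>B\<close>, by disjointness.\<close>

lemma card_touched_le:
  fixes A :: "nat \<Rightarrow> nat set"
  assumes "disjoint_family_on A I" "finite B"
  shows "finite {k\<in>I. A k \<inter> B \<noteq> {}}" "card {k\<in>I. A k \<inter> B \<noteq> {}} \<le> card B"
proof -
  define g where "g k = (SOME x. x \<in> A k \<inter> B)" for k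
  have g: "g k \<in> A k \<inter> B" if "A k \<inter> B \<noteq> {}" for k
    using that unfolding g_def some_in_eq .
  have inj: "inj_on g {k\<in>I. A k \<inter> B \<noteq> {}}"
  proof (rule inj_onI, rule ccontr)
    fix k l assume kl: "k \<in> {k\<in>I. A k \<inter> B \<noteq> {}}" "l \<in> {k\<in>I. A k \<inter> B \<noteq> {}}" "g k = g l" "k \<noteq> l"
    then have "g k \<in> A k \<inter> A l" using g[of k] g[of l] by auto
    then show False using assms(1) kl by (auto simp: disjoint_family_on_def)
  qed
  have sub: "g ` {k\<in>I. A k \<inter> B \<noteq> {}} \<subseteq> B" using g by blast
  show "finite {k\<in>I. A k \<inter> B \<noteq> {}}" by (rule inj_on_finite[OF inj sub assms(2)])
  show "card {k\<in>I. A k \<inter> B \<noteq> {}} \<le> card B" by (rule card_inj_on_le[OF inj sub assms(2)])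
qed

text \<open>
  The weights live on \<open>n - |B|\<close> bundles that avoid \<open>B\<close>; each bundle is normalised to weight 1, so
  losing value down to \<open>1/2\<close> costs weight at least \<open>1/2\<close>.
\<close>

lemma xos_bundle_weights:
  assumes P: "bundle_partition n M A" and x: "xos M C v" and M: "finite M"
    and v1: "\<And>k. k \<in> {1..n} \<Longrightarrow> 1 \<le> v (A k)" and B: "B \<subseteq> M" "card B \<le> n"
  obtains w :: "nat \<Rightarrow> real" where "\<And>e. e \<in> M \<Longrightarrow> 0 \<le> w e" "\<And>e. e \<in> M \<Longrightarrow> w e \<le> 1"
    "sum w M = real (n - card B)"
    "\<And>T L. T \<subseteq> M \<Longrightarrow> L \<subseteq> M \<Longrightarrow>
      real (n - card B) - card (T - B) - 2 * sum w L
        \<le> card {k\<in>{1..n}. 1 / 2 \<le> v (A k \<inter> (M - T - L))}"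
proof -
  have disj: "disjoint_family_on A {1..n}" and AM: "\<And>k. k \<in> {1..n} \<Longrightarrow> A k \<subseteq> M"
    using P by (auto simp: bundle_partition_def)
  have "\<exists>a. a \<in> C \<and> sum a (A k) = v (A k)" if "k \<in> {1..n}" for k
    using xos_valuation_clause[OF x AM[OF that]] by metis
  then obtain a where a: "\<And>k. k \<in> {1..n} \<Longrightarrow> a k \<in> C" "\<And>k. k \<in> {1..n} \<Longrightarrow> sum (a k) (A k) = v (A k)"
    using bchoice[of "{1..n}" "\<lambda>k a. a \<in> C \<and> sum a (A k) = v (A k)"] by blast
  have a0: "0 \<le> a k e" if "k \<in> {1..n}" "e \<in> M" for k e
    using x a(1)[OF that(1)] that(2) unfolding xos_def by blast
  have finA: "finite (A k)" if "k \<in> {1..n}" for k by (rule finite_subset[OF AM[OF that] M])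
  have "finite B" by (rule finite_subset[OF B(1) M])
  note tB = card_touched_le[OF disj this]
  \<comment> \<open>At least \<open>n - card B\<close> bundles avoid \<open>B\<close>. Keeping
    exactly that many makes the total weight a fixed number.\<close>
  have "n - card B \<le> card ({1..n} - {k\<in>{1..n}. A k \<inter> B \<noteq> {}})"
    using tB by (subst card_Diff_subset) auto
  from obtain_subset_with_card_n[OF this]
  obtain Q where Q: "Q \<subseteq> {1..n} - {k\<in>{1..n}. A k \<inter> B \<noteq> {}}" "card Q = n - card B" by metis
  have Qn: "Q \<subseteq> {1..n}" and QB: "\<And>k. k \<in> Q \<Longrightarrow> A k \<inter> B = {}" using Q by auto
  have disjQ: "A k \<inter> A l = {}" if "k \<in> Q" "l \<in> Q" "k \<noteq> l" for k l
    using disj Qn that by (auto simp: disjoint_family_on_def subset_iff)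
  have finQ: "finite Q" by (rule finite_subset[OF Qn]) simp
  \<comment> \<open>At most one summand is nonzero, as the bundles are disjoint: the supporting
    clause of the bundle containing \<open>e\<close>, normalised by the value of that
    bundle.\<close>
  define w where "w e = (\<Sum>k\<in>Q. if e \<in> A k then a k e / v (A k) else 0)" for e
  have wA: "w e = a k e / v (A k)" if "k \<in> Q" "e \<in> A k" for k e
  proof -
    have "w e = (\<Sum>l\<in>Q. if l = k then a k e / v (A k) else 0)"
      unfolding w_def using that disj Qn by (intro sum.cong) (auto simp: disjoint_family_on_def)
    then show ?thesis using that finQ by simp
  qed
  have w_out: "w e = 0" if "\<And>k. k \<in> Q \<Longrightarrow> e \<notin> A k" for e
    unfolding w_def using that by (simp add: sum.neutral)
  have wAk: "sum w (A k) = 1" if "k \<in> Q" for k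
  proof -
    have k: "k \<in> {1..n}" using that Qn by auto
    have "sum w (A k) = (\<Sum>e\<in>A k. a k e / v (A k))" using wA[OF that] by simp
    also have "\<dots> = 1" using a(2)[OF k] v1[OF k] by (simp add: sum_divide_distrib[symmetric])
    finally show ?thesis .
  qed
  have w0: "0 \<le> w e" if "e \<in> M" for e
    unfolding w_def using Qn a0 that v1 by (intro sum_nonneg) (force intro!: divide_nonneg_nonneg)
  show thesis
  proof (rule that[of w])
    show "w e \<le> 1" if "e \<in> M" for e
    proof (cases "\<exists>k\<in>Q. e \<in> A k")
      case True
      then obtain k where k: "k \<in> Q" "e \<in> A k" by auto
      have kn: "k \<in> {1..n}" using k Qn by auto
      have "w e \<le> sum w (A k)"
        using k AM[OF kn] w0 finA[OF kn] by (intro member_le_sum) auto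
      then show ?thesis using wAk[OF k(1)] by simp
    qed (use w_out in auto)
    have "(\<Union>k\<in>Q. A k) \<subseteq> M" using AM Qn by blast
    then have "sum w M = sum w (\<Union>k\<in>Q. A k)"
      using M w_out by (intro sum.mono_neutral_right) auto
    also have "\<dots> = (\<Sum>k\<in>Q. sum w (A k))"
      using disj finQ finA Qn by (intro sum.UNION_disjoint) (auto simp: disjoint_family_on_def subset_iff)
    finally show "sum w M = real (n - card B)" using wAk Q(2) by simp
    fix T L assume T: "T \<subseteq> M" and L: "L \<subseteq> M"
    define K where "K = {k\<in>{1..n}. 1 / 2 \<le> v (A k \<inter> (M - T - L))}"
    \<comment> \<open>A bundle of \<open>Q\<close> can drop out of \<open>K\<close> for two reasons
      only: it meets \<open>T - B\<close> (set \<open>Y\<close>), or more than half of its weight is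
      lost to \<open>L\<close> (set \<open>Z\<close>). Disjointness bounds \<open>Y\<close> by
      \<open>card (T - B)\<close>, and counting weight bounds \<open>Z\<close> by
      \<open>2 * sum w L\<close>.\<close>
    define Z where "Z = {k\<in>Q. 1 / 2 < sum w (A k \<inter> L)}"
    define Y where "Y = {k\<in>{1..n}. A k \<inter> (T - B) \<noteq> {}}"
    have finT: "finite T" "finite L" by (rule finite_subset[OF T M], rule finite_subset[OF L M])
    have Y: "finite Y" "card Y \<le> card (T - B)"
      using card_touched_le[OF disj, of "T - B"] finT by (auto simp: Y_def)
    have "k \<in> K" if k: "k \<in> Q" "k \<notin> Y" "k \<notin> Z" for k
    proof -
      have kn: "k \<in> {1..n}" using k Qn by auto
      have eq: "A k \<inter> (M - T - L) = A k - A k \<inter> L"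
        using k kn QB[OF k(1)] AM[OF kn] by (auto simp: Y_def)
      have "sum w (A k - A k \<inter> L) = 1 - sum w (A k \<inter> L)"
        using wAk[OF k(1)] finA[OF kn] by (subst sum_diff) auto
      then have "1 / 2 \<le> sum w (A k - A k \<inter> L)" using k by (auto simp: Z_def)
      also have "\<dots> = (\<Sum>e\<in>A k - A k \<inter> L. a k e / v (A k))" using wA[OF k(1)] by simp
      also have "\<dots> = sum (a k) (A k - A k \<inter> L) / v (A k)" by (simp add: sum_divide_distrib)
      \<comment> \<open>Normalising only shrinks the clause because \<open>v (A k)\<close> is at
        least 1, so normalised weight \<open>1 / 2\<close> guarantees real value
        \<open>1 / 2\<close>.\<close>
      also have "\<dots> \<le> sum (a k) (A k - A k \<inter> L) / 1"
        using v1[OF kn] AM[OF kn] a0[OF kn] by (intro divide_left_mono sum_nonneg) auto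
      also have "\<dots> \<le> v (A k - A k \<inter> L)"
        using xos_clause_le[OF x _ a(1)[OF kn], of "A k - A k \<inter> L"] AM[OF kn] by auto
      finally show ?thesis using kn eq by (simp add: K_def)
    qed
    then have "Q \<subseteq> K \<union> (Y \<union> Z)" by blast
    moreover have "finite (K \<union> (Y \<union> Z))" using Y finQ by (simp add: K_def Z_def)
    ultimately have "card Q \<le> card (K \<union> (Y \<union> Z))" by (rule card_mono[rotated])
    also have "\<dots> \<le> card K + (card Y + card Z)"
      using card_Un_le[of K "Y \<union> Z"] card_Un_le[of Y Z] by linarith
    finally have cQ: "card Q \<le> card K + (card Y + card Z)" .
    have "real (card Z) / 2 = (\<Sum>k\<in>Z. 1 / 2)" by simp
    also have "\<dots> \<le> (\<Sum>k\<in>Z. sum w (A k \<inter> L))" by (intro sum_mono) (auto simp: Z_def)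
    also have "\<dots> = sum w (\<Union>k\<in>Z. A k \<inter> L)"
      using finQ finT disjQ by (intro sum.UNION_disjoint[symmetric]) (simp_all add: Z_def, blast)
    also have "\<dots> \<le> sum w L" using finT w0 L by (intro sum_mono2) auto
    finally have "card Z \<le> 2 * sum w L" by simp
    then show "real (n - card B) - card (T - B) - 2 * sum w L \<le> card K"
      using cQ Y(2) Q(2) by linarith
  qed (rule w0)
qed

subsection \<open>Selection from a random bundle\<close>

lemma exp_minus_one_le: "exp x - 1 \<le> exp x * (x :: real)"
proof -
  have "exp x * (1 - x) \<le> exp x * exp (- x)"
    using exp_ge_add_one_self[of "- x"] by (intro mult_left_mono) auto
  then show ?thesis by (simp add: algebra_simps exp_minus)
qed

text \<open>A non-special round without failure is an ordinary \<open>pmf\<close>. Writing the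
  success weight as an expectation under it makes integral estimates applicable.\<close>

lemma weight_bind_select:
  assumes K: "finite K" "K \<noteq> {}"
  shows "weight_spmf (bind_spmf (bind_spmf (spmf_of_set K) (\<lambda>k. map_spmf g (spmf_of_pmf (p k)))) F)
    = measure_pmf.expectation (bind_pmf (pmf_of_set K) p) (\<lambda>S. weight_spmf (F (g S)))"
proof -
  have "bind_spmf (spmf_of_set K) (\<lambda>k. map_spmf g (spmf_of_pmf (p k)))
      = spmf_of_pmf (map_pmf g (bind_pmf (pmf_of_set K) p))"
    using K by (simp add: spmf_of_pmf_pmf_of_set[OF K, symmetric] spmf_of_pmf_bind map_bind_pmf
        del: spmf_of_pmf_pmf_of_set)
  then show ?thesis by (simp add: weight_bind_spmf o_def del: bind_spmf_of_pmf)
qed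

context
  fixes K :: "nat set" and s :: nat and es :: "nat \<Rightarrow> nat list" and R :: "nat set"
  assumes K: "finite K" "K \<noteq> {}" and s: "0 < s" and R: "finite R"
    and es: "\<And>k. k \<in> K \<Longrightarrow> distinct (es k)" "\<And>k. k \<in> K \<Longrightarrow> set (es k) \<subseteq> R"
      "\<And>k l. k \<in> K \<Longrightarrow> l \<in> K \<Longrightarrow> k \<noteq> l \<Longrightarrow> set (es k) \<inter> set (es l) = {}"
begin

abbreviation "mixture \<equiv> bind_pmf (pmf_of_set K) (\<lambda>k. select_from_blocks s (es k))"

lemma finite_set_mixture: "finite (set_pmf mixture)"
  using K es(1) s by (auto simp: intro: finite_set_select_from_blocks)

lemma set_mixture_subset:
  assumes "S \<in> set_pmf mixture"
  shows "S \<subseteq> R"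
proof -
  from assms K obtain k where k: "k \<in> K" "S \<in> set_pmf (select_from_blocks s (es k))" by auto
  show ?thesis using select_from_blocks_subset[OF s es(1)[OF k(1)] k(2)] es(2)[OF k(1)] by simp
qed

lemma expectation_mixture:
  fixes h :: "nat set \<Rightarrow> real"
  shows "measure_pmf.expectation mixture h
    = (\<Sum>k\<in>K. measure_pmf.expectation (select_from_blocks s (es k)) h) / card K"
  using K es(1) s
  by (subst pmf_expectation_bind_pmf_of_set)
    (auto simp: finite_set_select_from_blocks divide_inverse_commute sum_distrib_left)

lemma sum_bundles_le:
  fixes u :: "nat \<Rightarrow> real"
  assumes "\<And>e. e \<in> R \<Longrightarrow> 0 \<le> u e"
  shows "(\<Sum>k\<in>K. sum u (set (es k))) \<le> sum u R"
proof -
  have "(\<Sum>k\<in>K. sum u (set (es k))) = sum u (\<Union>k\<in>K. set (es k))"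
    using K es by (intro sum.UNION_disjoint[symmetric]) auto
  also have "\<dots> \<le> sum u R" using es R assms by (intro sum_mono2) auto
  finally show ?thesis .
qed

text \<open>A good lies in at most one of the lists, so it is lost with probability at most
  \<open>1 / (s * card K)\<close>: its bundle must be picked, and then the good itself from its
  block.\<close>

lemma expectation_sum_mixture_le:
  fixes u :: "nat \<Rightarrow> real"
  assumes u: "\<And>e. e \<in> R \<Longrightarrow> 0 \<le> u e"
  shows "measure_pmf.expectation mixture (sum u) \<le> sum u R / (s * card K)"
proof -
  have "(\<Sum>k\<in>K. measure_pmf.expectation (select_from_blocks s (es k)) (sum u))
      \<le> (\<Sum>k\<in>K. sum u (set (es k)) / s)"
    using es(1) subsetD[OF es(2)] u s by (intro sum_mono expectation_sum_select_le) auto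
  also have "\<dots> \<le> sum u R / s"
    using sum_bundles_le[OF u] by (simp add: sum_divide_distrib[symmetric] divide_right_mono)
  finally show ?thesis
    unfolding expectation_mixture using K by (simp add: divide_right_mono flip: divide_divide_eq_left)
qed

text \<open>A single bundle \<open>k\<close> has moment at most \<open>exp (z k)\<close>. As
  \<open>z k\<close> is at most \<open>b\<close>, this is at most \<open>1 + exp b * z k\<close>,
  which is linear in \<open>z k\<close>; hence averaging over \<open>K\<close> involves only the
  total weight and gains the factor \<open>1 / card K\<close>.\<close>

lemma expectation_exp_mixture_le:
  fixes u :: "nat \<Rightarrow> real"
  assumes u: "\<And>e. e \<in> R \<Longrightarrow> 0 \<le> u e" "\<And>e. e \<in> R \<Longrightarrow> u e \<le> 1" and l: "0 \<le> l"
    and b: "(exp l - 1) * sum u R / s \<le> b"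
  shows "measure_pmf.expectation mixture (\<lambda>S. exp (l * sum u S))
    \<le> 1 + exp b * ((exp l - 1) * sum u R / s) / card K"
proof -
  define z where "z k = (exp l - 1) * sum u (set (es k)) / s" for k
  have z0: "0 \<le> z k" if "k \<in> K" for k
    unfolding z_def using subsetD[OF es(2)[OF that]] u l by (intro divide_nonneg_nonneg mult_nonneg_nonneg sum_nonneg) auto
  have zsum: "(\<Sum>k\<in>K. z k) \<le> (exp l - 1) * sum u R / s"
    using sum_bundles_le[OF u(1)] l unfolding z_def
    by (auto simp: sum_divide_distrib[symmetric] sum_distrib_left[symmetric]
        intro!: divide_right_mono mult_left_mono)
  have zb: "z k \<le> b" if "k \<in> K" for k
    using member_le_sum[of k K z] that z0 K zsum b by force
  have "(\<Sum>k\<in>K. measure_pmf.expectation (select_from_blocks s (es k)) (\<lambda>S. exp (l * sum u S)))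
      \<le> (\<Sum>k\<in>K. 1 + exp b * z k)"
  proof (intro sum_mono)
    fix k assume k: "k \<in> K"
    have "measure_pmf.expectation (select_from_blocks s (es k)) (\<lambda>S. exp (l * sum u S)) \<le> exp (z k)"
      unfolding z_def using es(1)[OF k] subsetD[OF es(2)[OF k]] u s l
      by (intro expectation_exp_select_le) auto
    also have "exp (z k) \<le> 1 + exp (z k) * z k"
      using exp_minus_one_le[of "z k"] by simp
    also have "\<dots> \<le> 1 + exp b * z k" using zb[OF k] z0[OF k] by (auto intro!: mult_right_mono)
    finally show "measure_pmf.expectation (select_from_blocks s (es k)) (\<lambda>S. exp (l * sum u S))
      \<le> 1 + exp b * z k" .
  qed
  also have "\<dots> = card K + exp b * (\<Sum>k\<in>K. z k)" by (simp add: sum.distrib sum_distrib_left)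
  also have "\<dots> \<le> card K + exp b * ((exp l - 1) * sum u R / s)"
    using zsum by (intro add_left_mono mult_left_mono) auto
  finally have "measure_pmf.expectation mixture (\<lambda>S. exp (l * sum u S))
      \<le> (card K + exp b * ((exp l - 1) * sum u R / s)) / card K"
    unfolding expectation_mixture by (rule divide_right_mono) simp
  also have "\<dots> = 1 + exp b * ((exp l - 1) * sum u R / s) / card K"
    using K by (simp add: add_divide_distrib)
  finally show ?thesis .
qed

end

subsection \<open>The baseline\<close>

text \<open>
  The goods that remain if no good is ever removed in a non-special round. This deterministic
  process dominates every run of the algorithm.
\<close>

primrec special_baseline :: "nat list \<Rightarrow> real \<Rightarrow> (nat \<Rightarrow> nat set \<Rightarrow> real) \<Rightarrow> nat \<Rightarrow> nat set" where
  "special_baseline gs \<theta> v 0 = set gs"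
| "special_baseline gs \<theta> v (Suc i) =
    (case find (\<lambda>e. e \<in> special_baseline gs \<theta> v i \<and> v (Suc i) {e} \<ge> \<theta>) gs of
      Some e \<Rightarrow> special_baseline gs \<theta> v i - {e} | None \<Rightarrow> special_baseline gs \<theta> v i)"

text \<open>Compares the picks of the baseline and of the run: if the baseline's first suitable good
  is also available to the run, the run picks the same good, since fewer goods compete
  there.\<close>

lemma find_Some_weaken:
  assumes "find Q xs = Some x" "find P xs = Some y" "\<And>z. P z \<Longrightarrow> Q z" "P x"
  shows "x = y"
  using assms(1,2)
proof (induction xs)
  case (Cons a xs)
  then show ?case using assms(3)[of a] assms(4) by (cases "Q a"; cases "P a") auto
qed simp

lemma special_baseline_Suc_subset: "special_baseline gs \<theta> v (Suc i) \<subseteq> special_baseline gs \<theta> v i"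
  by (auto split: option.splits)

lemma special_baseline_antimono:
  "i \<le> j \<Longrightarrow> special_baseline gs \<theta> v j \<subseteq> special_baseline gs \<theta> v i"
  by (rule lift_Suc_antimono_le[of "special_baseline gs \<theta> v"]) (rule special_baseline_Suc_subset)

lemma special_baseline_subset: "special_baseline gs \<theta> v i \<subseteq> set gs"
  using special_baseline_antimono[of 0 i] by simp

text \<open>The number of special rounds of the baseline among the first \<open>i\<close>, since
  each removes exactly one good.\<close>

definition baseline_count :: "nat list \<Rightarrow> real \<Rightarrow> (nat \<Rightarrow> nat set \<Rightarrow> real) \<Rightarrow> nat \<Rightarrow> nat" where
  "baseline_count gs \<theta> v i = card (set gs - special_baseline gs \<theta> v i)"

lemma baseline_count_0 [simp]: "baseline_count gs \<theta> v 0 = 0"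
  by (simp add: baseline_count_def)

lemma baseline_count_mono: "i \<le> j \<Longrightarrow> baseline_count gs \<theta> v i \<le> baseline_count gs \<theta> v j"
  unfolding baseline_count_def by (intro card_mono) (use special_baseline_antimono[of i j] in auto)

lemma baseline_count_Suc:
  "baseline_count gs \<theta> v (Suc i) =
    (if find (\<lambda>e. e \<in> special_baseline gs \<theta> v i \<and> v (Suc i) {e} \<ge> \<theta>) gs = None
     then baseline_count gs \<theta> v i else Suc (baseline_count gs \<theta> v i))"
proof (cases "find (\<lambda>e. e \<in> special_baseline gs \<theta> v i \<and> v (Suc i) {e} \<ge> \<theta>) gs")
  case (Some e)
  then have "e \<in> set gs" "e \<in> special_baseline gs \<theta> v i" by (auto simp: find_Some_iff)
  then have "set gs - (special_baseline gs \<theta> v i - {e}) = insert e (set gs - special_baseline gs \<theta> v i)"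
    by auto
  then show ?thesis using Some \<open>e \<in> special_baseline gs \<theta> v i\<close> by (simp add: baseline_count_def)
qed (simp add: baseline_count_def)

lemma baseline_count_diff_le: "i \<le> j \<Longrightarrow> baseline_count gs \<theta> v j \<le> baseline_count gs \<theta> v i + (j - i)"
  by (induction j rule: dec_induct) (auto simp: baseline_count_Suc simp del: special_baseline.simps)

lemma baseline_count_le: "baseline_count gs \<theta> v i \<le> i"
  using baseline_count_diff_le[of 0 i] by simp

text \<open>\<open>rba_state_after\<close> appends rounds at the end. Peeling rounds off the front,
  from an arbitrary state, is what an induction on the number of rounds left requires.\<close>

primrec rba_run ::
    "nat \<Rightarrow> nat list \<Rightarrow> (nat \<Rightarrow> nat set \<Rightarrow> real) \<Rightarrow> (nat \<Rightarrow> nat \<Rightarrow> nat set) \<Rightarrow>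
     (nat \<Rightarrow> nat set \<Rightarrow> nat list) \<Rightarrow> nat \<Rightarrow> nat \<Rightarrow> rba_state \<Rightarrow> rba_state spmf" where
  "rba_run n gs v P \<sigma> 0 j = return_spmf"
| "rba_run n gs v P \<sigma> (Suc k) j =
    (\<lambda>st. bind_spmf (rba_round n gs v P \<sigma> (Suc j) st) (rba_run n gs v P \<sigma> k (Suc j)))"

lemma rba_state_after_add:
  "rba_state_after n gs v P \<sigma> (j + k) = bind_spmf (rba_state_after n gs v P \<sigma> j) (rba_run n gs v P \<sigma> k j)"
proof (induction k arbitrary: j)
  case (Suc k)
  from Suc[of "Suc j"] show ?case by simp
qed simp

subsection \<open>The potential\<close>

text \<open>
  The factor 264 in \<open>lam\<close> makes \<open>lam i * d i / 8 = 33 * min (d i) s\<close>; as \<open>s\<close> is at least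
  \<open>ln n / 32\<close>, this leaves room for a union bound over the \<open>n\<close> agents.
\<close>

definition rate_bound :: real where "rate_bound = 264 * exp 264"

text \<open>\<open>w i\<close> belongs to agent \<open>Suc i\<close>, who arrives after
  \<open>i\<close> rounds. The weight assumptions are the conclusions of
  \<open>xos_bundle_weights\<close>, with \<open>B\<close> the goods taken by the baseline in those
  \<open>i\<close> rounds; the XOS structure enters the failure analysis only through them.\<close>

locale rba_potential =
  fixes n :: nat and gs :: "nat list" and v :: "nat \<Rightarrow> nat set \<Rightarrow> real"
    and P :: "nat \<Rightarrow> nat \<Rightarrow> nat set" and \<sigma> :: "nat \<Rightarrow> nat set \<Rightarrow> nat list"
    and \<theta> :: real and s :: nat and w :: "nat \<Rightarrow> nat \<Rightarrow> real"
  assumes \<theta>_eq: "\<theta> = 1 / (4 * ln (real n))" and s_eq: "s = nat \<lfloor>ln (real n) / 16\<rfloor>" and s_pos: "0 < s"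
    and partition: "\<And>i. i < n \<Longrightarrow> bundle_partition n (set gs) (P (Suc i))"
    and order: "\<And>i G. i < n \<Longrightarrow> G \<subseteq> set gs \<Longrightarrow> distinct (\<sigma> (Suc i) G) \<and> set (\<sigma> (Suc i) G) = G"
    and w_nonneg: "\<And>i e. i < n \<Longrightarrow> e \<in> set gs \<Longrightarrow> 0 \<le> w i e"
    and w_le_1: "\<And>i e. i < n \<Longrightarrow> e \<in> set gs \<Longrightarrow> w i e \<le> 1"
    and w_total: "\<And>i. i < n \<Longrightarrow> sum (w i) (set gs) = real (n - baseline_count gs \<theta> v i)"
    and w_bundles: "\<And>i T L. i < n \<Longrightarrow> T \<subseteq> set gs \<Longrightarrow> L \<subseteq> set gs \<Longrightarrow>
      real (n - baseline_count gs \<theta> v i) - card (T - (set gs - special_baseline gs \<theta> v i))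
        - 2 * sum (w i) L
      \<le> card {k\<in>{1..n}. 1 / 2 \<le> v (Suc i) (P (Suc i) k \<inter> (set gs - T - L))}"
begin

abbreviation "M \<equiv> set gs"
abbreviation "base \<equiv> special_baseline gs \<theta> v"
abbreviation "tb \<equiv> baseline_count gs \<theta> v"

definition d :: "nat \<Rightarrow> nat" where "d i = n - tb i"
text \<open>The number of non-special rounds of the whole baseline, raised to at least 1 so that it
  can be a divisor.\<close>

definition N :: nat where "N = max 1 (n - tb n)"
text \<open>Counts the goods of \<open>L\<close> that the baseline takes in some special round. The
  form as a sum fits the expectation bounds for additive weights.\<close>

definition lost :: "nat set \<Rightarrow> real" where "lost L = sum (indicator (M - base n)) L"
definition lam :: "nat \<Rightarrow> real" where "lam i = 264 * min 1 (s / d i)"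
text \<open>A non-special round multiplies the expected exponential moment of agent
  \<open>Suc i\<close> by at most \<open>1 + bet i\<close>, hence by at most
  \<open>exp (bet i)\<close>.\<close>

definition bet :: "nat \<Rightarrow> real" where "bet i = 2 * exp rate_bound * (exp (lam i) - 1) / s"

text \<open>Exponential potential for the lost weight, with \<open>bet i\<close> reserved for each
  of \<open>2 * N - q\<close> further non-special rounds. It is at least 1 once the lost weight
  reaches \<open>d i / 8\<close>. Subtracting 1 above and below gives the initial bound a factor
  \<open>1 / s\<close>.\<close>

definition phi :: "nat \<Rightarrow> nat \<Rightarrow> nat set \<Rightarrow> real" where
  "phi i q L = (exp (lam i * sum (w i) L + bet i * real (2 * N - q)) - 1) / (exp (lam i * d i / 8) - 1)"

text \<open>The first summand is Markov's bound for the event that \<open>lost L\<close> reaches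
  \<open>N / 8\<close>, with \<open>2 / s\<close> reserved per further non-special round; the second
  is a union bound over the agents still to come. The budget \<open>2 * N\<close> suffices by
  \<open>nonspecial_rounds_less\<close>.\<close>

definition psi :: "nat \<Rightarrow> nat \<Rightarrow> nat set \<Rightarrow> real" where
  "psi j q L = (lost L + 2 / s * real (2 * N - q)) / (N / 8) + (\<Sum>i\<in>{j..<n}. phi i q L)"

text \<open>
  \<open>T\<close> and \<open>L\<close> are the goods removed so far in special and in non-special rounds.
\<close>

definition reachable :: "nat \<Rightarrow> nat set \<Rightarrow> nat set \<Rightarrow> bool" where
  "reachable j T L \<longleftrightarrow> T \<subseteq> M \<and> L \<subseteq> M \<and> T \<inter> L = {} \<and> M - T - L \<subseteq> base j \<and> card T \<le> tb j"

lemma d_pos: "i < n \<Longrightarrow> 0 < d i"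
  using baseline_count_le[of gs \<theta> v i] by (simp add: d_def)

lemma N_pos: "0 < N" by (simp add: N_def)

lemma N_le_d: "i < n \<Longrightarrow> N \<le> d i"
  using d_pos[of i] baseline_count_mono[of i n gs \<theta> v] by (auto simp: N_def d_def)

lemma lam_pos: "i < n \<Longrightarrow> 0 < lam i"
  using d_pos[of i] s_pos by (simp add: lam_def)

lemma bet_nonneg: "i < n \<Longrightarrow> 0 \<le> bet i"
  using lam_pos[of i] by (simp add: bet_def)

lemma denominator_pos: "i < n \<Longrightarrow> 0 < exp (lam i * d i / 8) - 1"
  using lam_pos[of i] d_pos[of i] by simp

lemma lam_d: "i < n \<Longrightarrow> lam i * d i = 264 * min (d i) s"
  using d_pos[of i] by (auto simp: lam_def min_def field_simps)

text \<open>Since \<open>lam i\<close> is at most 264, \<open>exp (lam i) - 1\<close> is at most a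
  constant times \<open>lam i\<close>. The factor \<open>min (d i) s\<close> is kept because
  \<open>phi_0_le\<close> cancels it.\<close>

lemma rate_le:
  assumes "i < n"
  shows "(exp (lam i) - 1) * d i / s \<le> rate_bound * min (d i) s / s"
proof -
  have l: "lam i \<le> 264" "0 < lam i" using lam_pos[OF assms] by (auto simp: lam_def)
  have "exp (lam i) - 1 \<le> exp (lam i) * lam i" by (rule exp_minus_one_le)
  also have "\<dots> \<le> exp 264 * lam i" using l by (intro mult_right_mono) auto
  finally have "(exp (lam i) - 1) * d i / s \<le> exp 264 * lam i * d i / s"
    by (intro divide_right_mono mult_right_mono) auto
  also have "exp 264 * lam i * d i / s = rate_bound * min (d i) s / s"
    by (simp add: rate_bound_def mult.assoc lam_d[OF assms])
  finally show ?thesis .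
qed

lemma rate_le_bound:
  assumes "i < n"
  shows "(exp (lam i) - 1) * d i / s \<le> rate_bound"
proof -
  have "rate_bound * min (d i) s / s \<le> rate_bound * s / s"
    by (intro divide_right_mono mult_left_mono) (auto simp: rate_bound_def)
  then show ?thesis using rate_le[OF assms] s_pos by simp
qed

lemma sum_w_nonneg: "i < n \<Longrightarrow> L \<subseteq> M \<Longrightarrow> 0 \<le> sum (w i) L"
  using w_nonneg[of i] by (intro sum_nonneg) auto

lemma phi_nonneg: "i < n \<Longrightarrow> L \<subseteq> M \<Longrightarrow> 0 \<le> phi i q L"
  unfolding phi_def using lam_pos[of i] bet_nonneg[of i] sum_w_nonneg[of i L] denominator_pos[of i]
  by (intro divide_nonneg_pos) auto

lemma lost_nonneg: "0 \<le> lost L"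
  by (simp add: lost_def sum_nonneg)

lemma lost_eq_card: "finite L \<Longrightarrow> lost L = card (L \<inter> (M - base n))"
  by (simp add: lost_def indicator_def sum.If_cases Int_def)

lemma psi_nonneg: "L \<subseteq> M \<Longrightarrow> 0 \<le> psi j q L"
  unfolding psi_def using lost_nonneg[of L]
  by (intro add_nonneg_nonneg divide_nonneg_nonneg sum_nonneg phi_nonneg mult_nonneg_nonneg) auto

lemma psi_Suc_le:
  assumes "L \<subseteq> M" "j < n"
  shows "psi (Suc j) q L \<le> psi j q L"
  using phi_nonneg[OF assms(2,1), of q] assms(2)
  by (simp add: psi_def sum.atLeast_Suc_lessThan[of j n])

section \<open>Deviation of a reachable state from the baseline\<close>

context
  fixes j T L
  assumes r: "reachable j T L" and j: "j \<le> n"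
begin

lemma finite_removed: "finite T" "finite L"
  using r finite_subset unfolding reachable_def by blast+

lemma baseline_removed_subset: "M - base j \<subseteq> T \<union> L \<inter> (M - base n)"
  using r special_baseline_antimono[OF j, of gs \<theta> v] unfolding reachable_def by blast

lemma tb_le: "tb j \<le> card T + lost L"
proof -
  have "tb j \<le> card (T \<union> L \<inter> (M - base n))"
    unfolding baseline_count_def using baseline_removed_subset finite_removed by (intro card_mono) auto
  also have "\<dots> \<le> card T + card (L \<inter> (M - base n))" by (rule card_Un_le)
  finally show ?thesis by (simp add: lost_eq_card finite_removed)
qed

text \<open>An exchange count: \<open>T\<close> is no larger than \<open>M - base j\<close> and
  misses at most \<open>lost L\<close> of its elements, so it has at most \<open>lost L\<close>
  elements outside.\<close>

lemma card_extra_special_le: "card (T - (M - base j)) \<le> lost L"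
proof -
  have "tb j \<le> card (T \<inter> (M - base j) \<union> L \<inter> (M - base n))"
    unfolding baseline_count_def using baseline_removed_subset finite_removed by (intro card_mono) auto
  also have "\<dots> \<le> card (T \<inter> (M - base j)) + card (L \<inter> (M - base n))" by (rule card_Un_le)
  finally have "tb j \<le> card (T \<inter> (M - base j)) + card (L \<inter> (M - base n))" .
  moreover have "card T = card (T \<inter> (M - base j)) + card (T - (M - base j))"
    using finite_removed by (metis card_Diff_subset_Int card_mono finite_Int inf_le1 le_add_diff_inverse)
  moreover have "card T \<le> tb j" using r by (simp add: reachable_def)
  ultimately show ?thesis by (simp add: lost_eq_card finite_removed)
qed

lemma card_special_le: "card T \<le> tb j" "card T \<le> j"
  using r baseline_count_le[of gs \<theta> v j] by (auto simp: reachable_def)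

text \<open>The baseline has at most \<open>N\<close> non-special rounds, and by
  \<open>tb_le\<close> the run has at most \<open>lost L\<close> more.\<close>

lemma nonspecial_rounds_less:
  assumes "lost L < N / 8"
  shows "j - card T < 2 * N"
proof -
  have "real j - tb j \<le> real n - tb n"
    using baseline_count_diff_le[OF j, of gs \<theta> v] j by linarith
  also have "\<dots> \<le> N" by (simp add: N_def)
  finally have "real j - card T < N + N / 8" using tb_le assms by linarith
  then show ?thesis using card_special_le(2) N_pos by linarith
qed

lemma d_le_special: "j \<le> i \<Longrightarrow> d i \<le> n - card T"
  using card_special_le(1) baseline_count_mono[of j i gs \<theta> v] by (simp add: d_def)

end

text \<open>The remaining goods have weight at most \<open>d i\<close>, which is at most
  \<open>2 * card K\<close>, so the expected moment grows by a factor of at most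
  \<open>exp (bet i)\<close>. Lowering the budget by one round pays for exactly this factor.\<close>

lemma expectation_phi_le:
  assumes K: "finite K" "K \<noteq> {}" and R: "R \<subseteq> M"
    and es: "\<And>k. k \<in> K \<Longrightarrow> distinct (es k)" "\<And>k. k \<in> K \<Longrightarrow> set (es k) \<subseteq> R"
      "\<And>k l. k \<in> K \<Longrightarrow> l \<in> K \<Longrightarrow> k \<noteq> l \<Longrightarrow> set (es k) \<inter> set (es l) = {}"
    and i: "i < n" "d i \<le> 2 * card K" and L: "L \<subseteq> M" "L \<inter> R = {}" and q: "q < 2 * N"
  shows "measure_pmf.expectation (mixture K s es) (\<lambda>S. phi i (Suc q) (L \<union> S)) \<le> phi i q L"
proof -
  let ?D = "mixture K s es"
  have fR: "finite R" and fL: "finite L" using R L(1) by (auto intro: finite_subset)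
  note mix = K s_pos fR es
  define a where "a = lam i * sum (w i) L + bet i * real (2 * N - Suc q)"
  define den where "den = exp (lam i * d i / 8) - 1"
  have den: "0 < den" using denominator_pos[OF i(1)] by (simp add: den_def)
  have int: "integrable ?D f" for f :: "nat set \<Rightarrow> real"
    by (intro integrable_measure_pmf_finite finite_set_mixture[OF mix])
  have phi: "phi i (Suc q) (L \<union> S) = (exp a * exp (lam i * sum (w i) S) - 1) / den"
    if "S \<in> set_pmf ?D" for S
  proof -
    have S: "S \<subseteq> R" using set_mixture_subset[OF mix that] .
    then have "sum (w i) (L \<union> S) = sum (w i) L + sum (w i) S"
      using fL fR L(2) finite_subset by (intro sum.union_disjoint) auto
    then show ?thesis
      by (simp add: phi_def a_def den_def exp_add[symmetric] algebra_simps del: of_nat_diff)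
  qed
  have wR: "0 \<le> sum (w i) R" "sum (w i) R \<le> d i"
    using R w_nonneg[OF i(1)] w_total[OF i(1)]
    by (auto simp: d_def[symmetric] intro!: sum_nonneg sum_mono2 simp flip: w_total[OF i(1), folded d_def])
  have e0: "0 \<le> exp (lam i) - 1" using lam_pos[OF i(1)] by simp
  have rate: "(exp (lam i) - 1) * sum (w i) R / s \<le> (exp (lam i) - 1) * d i / s"
    using wR e0 by (intro divide_right_mono mult_left_mono) auto
  have "measure_pmf.expectation ?D (\<lambda>S. exp (lam i * sum (w i) S))
      \<le> 1 + exp rate_bound * ((exp (lam i) - 1) * sum (w i) R / s) / card K"
    using R w_nonneg[OF i(1)] w_le_1[OF i(1)] lam_pos[OF i(1)]
    by (intro expectation_exp_mixture_le[OF mix] order_trans[OF rate rate_le_bound[OF i(1)]]) auto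
  also have "\<dots> \<le> 1 + exp rate_bound * ((exp (lam i) - 1) * d i / s) / card K"
    by (intro add_left_mono divide_right_mono mult_left_mono[OF rate]) auto
  also have "\<dots> = 1 + (exp rate_bound * (exp (lam i) - 1) / s) * (d i / card K)"
    by simp
  also have "\<dots> \<le> 1 + (exp rate_bound * (exp (lam i) - 1) / s) * 2"
  proof -
    have "real (d i) / card K \<le> 2" using i(2) K by (simp add: divide_le_eq card_gt_0_iff)
    then show ?thesis using e0 by (intro add_left_mono mult_left_mono) auto
  qed
  also have "\<dots> = 1 + bet i" by (simp add: bet_def)
  also have "\<dots> \<le> exp (bet i)" by (rule exp_ge_add_one_self)
  finally have E: "measure_pmf.expectation ?D (\<lambda>S. exp (lam i * sum (w i) S)) \<le> exp (bet i)" .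
  have "measure_pmf.expectation ?D (\<lambda>S. phi i (Suc q) (L \<union> S))
      = measure_pmf.expectation ?D (\<lambda>S. (exp a * exp (lam i * sum (w i) S) - 1) / den)"
    using phi by (intro integral_cong_AE) (auto simp: AE_measure_pmf_iff)
  also have "\<dots> = (exp a * measure_pmf.expectation ?D (\<lambda>S. exp (lam i * sum (w i) S)) - 1) / den"
    using int by simp
  also have "\<dots> \<le> (exp a * exp (bet i) - 1) / den"
    using E den by (intro divide_right_mono diff_right_mono mult_left_mono) auto
  \<comment> \<open>\<open>q < 2 * N\<close> keeps the truncated subtraction exact, so the budget
    really drops by one.\<close>
  also have "exp a * exp (bet i) = exp (lam i * sum (w i) L + bet i * real (2 * N - q))"
  proof -
    have "2 * N - q = Suc (2 * N - Suc q)" using q by simp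
    then show ?thesis by (simp add: a_def exp_add[symmetric] algebra_simps del: of_nat_diff)
  qed
  finally show ?thesis by (simp add: phi_def den_def)
qed

text \<open>As \<open>R\<close> lies in \<open>base j\<close>, it contains at most
  \<open>tb n - tb j\<close> of the baseline's special goods, which is at most \<open>d j\<close>.
  Each is lost with probability at most \<open>1 / (s * card K)\<close>.\<close>

lemma expectation_lost_le:
  assumes K: "finite K" "K \<noteq> {}" and R: "R \<subseteq> base j" "j \<le> n"
    and es: "\<And>k. k \<in> K \<Longrightarrow> distinct (es k)" "\<And>k. k \<in> K \<Longrightarrow> set (es k) \<subseteq> R"
      "\<And>k l. k \<in> K \<Longrightarrow> l \<in> K \<Longrightarrow> k \<noteq> l \<Longrightarrow> set (es k) \<inter> set (es l) = {}"
    and d: "d j \<le> 2 * card K" and L: "L \<subseteq> M" "L \<inter> R = {}"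
  shows "measure_pmf.expectation (mixture K s es) (\<lambda>S. lost (L \<union> S)) \<le> lost L + 2 / s"
proof -
  let ?D = "mixture K s es"
  have RM: "R \<subseteq> M" using R special_baseline_subset[of gs \<theta> v j] by blast
  have fR: "finite R" and fL: "finite L" using RM L(1) by (auto intro: finite_subset)
  note mix = K s_pos fR es
  have int: "integrable ?D f" for f :: "nat set \<Rightarrow> real"
    by (intro integrable_measure_pmf_finite finite_set_mixture[OF mix])
  have lost: "lost (L \<union> S) = lost L + sum (indicator (M - base n)) S" if "S \<in> set_pmf ?D" for S
  proof -
    have "S \<subseteq> R" using set_mixture_subset[OF mix that] .
    then show ?thesis unfolding lost_def
      using fL fR L(2) finite_subset by (intro sum.union_disjoint) auto
  qed
  have "lost R \<le> d j"
  proof -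
    have "card (R \<inter> (M - base n)) \<le> card ((M - base n) - (M - base j))"
      using R by (intro card_mono) auto
    also have "\<dots> = tb n - tb j" unfolding baseline_count_def
      using special_baseline_antimono[OF R(2), of gs \<theta> v] by (intro card_Diff_subset) auto
    also have "\<dots> \<le> d j" using baseline_count_le[of gs \<theta> v n] by (simp add: d_def)
    finally show ?thesis using fR by (simp add: lost_eq_card)
  qed
  have "measure_pmf.expectation ?D (sum (indicator (M - base n))) \<le> lost R / (s * card K)"
    unfolding lost_def by (rule expectation_sum_mixture_le[OF mix]) auto
  also have "\<dots> \<le> (2 * card K) / (s * card K)"
    using \<open>lost R \<le> d j\<close> d by (intro divide_right_mono) auto
  also have "\<dots> = 2 / s" using K by simp
  finally have E: "measure_pmf.expectation ?D (sum (indicator (M - base n))) \<le> 2 / s" .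
  have "measure_pmf.expectation ?D (\<lambda>S. lost (L \<union> S))
      = measure_pmf.expectation ?D (\<lambda>S. lost L + sum (indicator (M - base n)) S)"
    using lost by (intro integral_cong_AE) (auto simp: AE_measure_pmf_iff)
  also have "\<dots> = lost L + measure_pmf.expectation ?D (sum (indicator (M - base n)))"
    using int by simp
  finally show ?thesis using E by simp
qed

lemma expectation_psi_le:
  assumes K: "finite K" "K \<noteq> {}" and R: "R \<subseteq> base j" "j \<le> n"
    and es: "\<And>k. k \<in> K \<Longrightarrow> distinct (es k)" "\<And>k. k \<in> K \<Longrightarrow> set (es k) \<subseteq> R"
      "\<And>k l. k \<in> K \<Longrightarrow> l \<in> K \<Longrightarrow> k \<noteq> l \<Longrightarrow> set (es k) \<inter> set (es l) = {}"
    and d: "d j \<le> 2 * card K" and L: "L \<subseteq> M" "L \<inter> R = {}" and q: "q < 2 * N"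
  shows "measure_pmf.expectation (mixture K s es) (\<lambda>S. psi (Suc j) (Suc q) (L \<union> S)) \<le> psi (Suc j) q L"
proof -
  let ?D = "mixture K s es"
  have RM: "R \<subseteq> M" using R special_baseline_subset[of gs \<theta> v j] by blast
  have fR: "finite R" using RM by (auto intro: finite_subset)
  note mix = K s_pos fR es
  have int: "integrable ?D f" for f :: "nat set \<Rightarrow> real"
    by (intro integrable_measure_pmf_finite finite_set_mixture[OF mix])
  have "measure_pmf.expectation ?D (\<lambda>S. psi (Suc j) (Suc q) (L \<union> S))
     = (measure_pmf.expectation ?D (\<lambda>S. lost (L \<union> S)) + 2 / s * real (2 * N - Suc q)) / (N / 8)
      + (\<Sum>i\<in>{Suc j..<n}. measure_pmf.expectation ?D (\<lambda>S. phi i (Suc q) (L \<union> S)))"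
    unfolding psi_def using int by simp
  also have "\<dots> \<le> (lost L + 2 / s + 2 / s * real (2 * N - Suc q)) / (N / 8) + (\<Sum>i\<in>{Suc j..<n}. phi i q L)"
  proof (intro add_mono divide_right_mono sum_mono)
    show "measure_pmf.expectation ?D (\<lambda>S. lost (L \<union> S)) \<le> lost L + 2 / s"
      by (rule expectation_lost_le) (use assms in auto)
    fix i assume i: "i \<in> {Suc j..<n}"
    then have "d i \<le> d j" using baseline_count_mono[of j i gs \<theta> v] by (simp add: d_def)
    then show "measure_pmf.expectation ?D (\<lambda>S. phi i (Suc q) (L \<union> S)) \<le> phi i q L"
      using expectation_phi_le[OF K RM es _ _ L q, where i=i] i d by simp
  qed auto
  also have "2 / s + 2 / s * real (2 * N - Suc q) = 2 / s * real (2 * N - q)"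
  proof -
    have "2 * N - q = Suc (2 * N - Suc q)" using q by simp
    then show ?thesis by (simp add: algebra_simps del: of_nat_diff)
  qed
  then have "lost L + 2 / s + 2 / s * real (2 * N - Suc q) = lost L + 2 / s * real (2 * N - q)" by linarith
  finally show ?thesis by (simp add: psi_def)
qed

section \<open>Round-by-round comparison with the baseline and the success probability\<close>

lemma rba_round_eq:
  "rba_round n gs v P \<sigma> i (R, t, A) =
     (case find (\<lambda>e. e \<in> R \<and> v i {e} \<ge> \<theta>) gs of
       Some e \<Rightarrow> return_spmf (R - {e}, t + 1, A(i := {e}))
     | None \<Rightarrow>
         (let K = {k \<in> {1..n}. v i (P i k \<inter> R) \<ge> 1 / 2}
          in if real (card K) < (real n - real t) / 2 then return_pmf None
             else bind_spmf (spmf_of_set K) (\<lambda>k.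
                  map_spmf (\<lambda>S. (R - S, t, A(i := S)))
                    (spmf_of_pmf (select_from_blocks s (\<sigma> i (P i k \<inter> R)))))))"
  unfolding rba_round_def \<theta>_eq s_eq Let_def prod.case ..

text \<open>A large good in the run is also in the baseline, so the baseline round is special too.
  Its pick \<open>e0\<close> is either already gone from the run or equal to the run's pick
  \<open>e\<close>; in both cases the inclusion survives.\<close>

lemma reachable_special:
  assumes r: "reachable j T L"
    and e: "find (\<lambda>e. e \<in> M - T - L \<and> v (Suc j) {e} \<ge> \<theta>) gs = Some e"
  shows "reachable (Suc j) (insert e T) L" "e \<in> M - T - L"
proof -
  have sub: "M - T - L \<subseteq> base j" using r by (simp add: reachable_def)
  have e': "e \<in> M - T - L" "v (Suc j) {e} \<ge> \<theta>" using e by (auto simp: find_Some_iff)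
  show "e \<in> M - T - L" by fact
  obtain e0 where e0: "find (\<lambda>e. e \<in> base j \<and> v (Suc j) {e} \<ge> \<theta>) gs = Some e0"
    using e' sub by (cases "find (\<lambda>e. e \<in> base j \<and> v (Suc j) {e} \<ge> \<theta>) gs") (auto simp: find_None_iff)
  have "e0 \<notin> M - T - L \<or> e0 = e"
  proof (rule disjCI)
    assume "\<not> e0 = e"
    show "e0 \<notin> M - T - L"
    proof
      assume "e0 \<in> M - T - L"
      moreover have "v (Suc j) {e0} \<ge> \<theta>" using e0 by (auto simp: find_Some_iff)
      ultimately show False using find_Some_weaken[OF e0 e] sub \<open>e0 \<noteq> e\<close> by blast
    qed
  qed
  then have "M - insert e T - L \<subseteq> base (Suc j)" using e0 sub by auto
  moreover have "card (insert e T) \<le> tb (Suc j)"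
    using e0 e' r by (subst baseline_count_Suc) (auto simp: reachable_def intro: card_insert_le_m1 le_trans[OF card_insert_le_m1])
  ultimately show "reachable (Suc j) (insert e T) L" using r e' by (auto simp: reachable_def)
qed

text \<open>The baseline may still take a good here, but that good is large for the agent and hence
  no longer among the goods of the run.\<close>

lemma reachable_nonspecial:
  assumes r: "reachable j T L"
    and none: "find (\<lambda>e. e \<in> M - T - L \<and> v (Suc j) {e} \<ge> \<theta>) gs = None"
    and S: "S \<subseteq> M - T - L"
  shows "reachable (Suc j) T (L \<union> S)"
proof -
  have "M - T - L \<subseteq> base (Suc j)"
    using none r by (auto simp: reachable_def find_None_iff find_Some_iff split: option.splits)
  moreover have "card T \<le> tb (Suc j)"
    using r baseline_count_mono[of j "Suc j" gs \<theta> v] by (auto simp: reachable_def)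
  ultimately show ?thesis using r S by (auto simp: reachable_def)
qed

text \<open>The weight is the probability of finishing without failure. Induction on the number of
  rounds left: the bound is trivial where \<open>psi\<close> is at least 1, in particular upon
  failure, and otherwise the supermartingale property carries it through the round.\<close>

lemma weight_rba_run_ge:
  assumes "reachable j T L" "j + k = n"
  shows "1 - psi j (j - card T) L \<le> weight_spmf (rba_run n gs v P \<sigma> k j (M - T - L, card T, A))"
  using assms
proof (induction k arbitrary: j T L A)
  case 0
  then show ?case using psi_nonneg[of L] by (simp add: reachable_def)
next
  case (Suc k)
  have r: "reachable j T L" and j: "j < n" "j \<le> n" using Suc.prems by auto
  have LM: "L \<subseteq> M" using r by (simp add: reachable_def)
  define R where "R = M - T - L"
  define q where "q = j - card T"
  note card_T = card_special_le[OF r j(2)]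
  show ?case
  proof (cases "lost L < N / 8")
    case False
    then have "1 \<le> (lost L + 2 / s * real (2 * N - q)) / (N / 8)"
      using N_pos by (simp add: le_divide_eq del: of_nat_diff) (smt (verit) divide_nonneg_nonneg mult_nonneg_nonneg of_nat_0_le_iff)
    moreover have "0 \<le> (\<Sum>i\<in>{j..<n}. phi i q L)" using LM by (intro sum_nonneg phi_nonneg) auto
    ultimately have "1 \<le> psi j q L" by (simp add: psi_def)
    then show ?thesis unfolding q_def by (meson diff_le_0_iff_le order_trans weight_spmf_nonneg)
  next
    case True
    note q = nonspecial_rounds_less[OF r j(2) True, folded q_def]
    show ?thesis
    proof (cases "find (\<lambda>e. e \<in> R \<and> v (Suc j) {e} \<ge> \<theta>) gs")
      case (Some e)
      note r' = reachable_special[OF r Some[unfolded R_def]]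
      have cT: "card (insert e T) = Suc (card T)" using r'(2) finite_removed[OF r j(2)] by simp
      have run: "rba_run n gs v P \<sigma> (Suc k) j (R, card T, A)
        = rba_run n gs v P \<sigma> k (Suc j) (R - {e}, card (insert e T), A(Suc j := {e}))"
        using Some by (simp add: rba_round_eq cT)
      \<comment> \<open>A special round raises \<open>j\<close> and \<open>card T\<close> together
        and leaves \<open>q\<close> fixed, so \<open>psi\<close> only loses the summand of the
        current agent.\<close>
      have "1 - psi j q L \<le> 1 - psi (Suc j) q L" using psi_Suc_le[OF LM j(1)] by simp
      also have "q = Suc j - card (insert e T)" by (simp add: cT q_def)
      also have "1 - psi (Suc j) (Suc j - card (insert e T)) L
        \<le> weight_spmf (rba_run n gs v P \<sigma> k (Suc j) (M - insert e T - L, card (insert e T), A(Suc j := {e})))"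
        by (rule Suc.IH[OF r'(1)]) (use Suc.prems in simp)
      also have "M - insert e T - L = R - {e}" by (auto simp: R_def)
      finally show ?thesis unfolding run[symmetric] by (simp only: q_def R_def cT diff_Suc_Suc)
    next
      case None
      define K where "K = {k \<in> {1..n}. v (Suc j) (P (Suc j) k \<inter> R) \<ge> 1 / 2}"
      define es where "es k = \<sigma> (Suc j) (P (Suc j) k \<inter> R)" for k
      have nT: "real n - real (card T) = real (n - card T)" using card_T j by simp
      show ?thesis
      proof (cases "real (card K) < (real n - real (card T)) / 2")
        case True
        have "real (d j) - card (T - (M - base j)) - 2 * sum (w j) L \<le> card K"
          unfolding K_def R_def d_def using r by (intro w_bundles j(1)) (auto simp: reachable_def)
        moreover have "card (T - (M - base j)) \<le> N / 8"
          using card_extra_special_le[OF r j(2)] \<open>lost L < N / 8\<close> by linarith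
        moreover have "real n - card T \<le> d j + N / 8"
          using tb_le[OF r j(2)] \<open>lost L < N / 8\<close> baseline_count_le[of gs \<theta> v j] j by (simp add: d_def)
        moreover have "0 \<le> real (d j)" by simp
        moreover have "real N \<le> d j" using N_le_d[OF j(1)] by simp
        \<comment> \<open>Read \<open>a = d j\<close>, \<open>b = N\<close>,
          \<open>c = card K\<close>, \<open>y = sum (w j) L\<close>. The hypotheses give
          \<open>2 * y > a / 2 - 3 * b / 16\<close>, which is at least
          \<open>5 * a / 16\<close>.\<close>
        moreover have "a / 8 \<le> y" if "a - x - 2 * y \<le> c" "x \<le> b / 8" "z \<le> a + b / 8" "0 \<le> a" "b \<le> a"
          "c < z / 2" for a b c x y z :: real
          using that by argo
        ultimately have "d j / 8 \<le> sum (w j) L" using True by blast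
        then have "lam j * d j / 8 \<le> lam j * sum (w j) L + bet j * real (2 * N - q)"
          using lam_pos[OF j(1)] bet_nonneg[OF j(1)] mult_left_mono[of "d j / 8" "sum (w j) L" "lam j"]
          by (smt (verit) mult_nonneg_nonneg of_nat_0_le_iff times_divide_eq_right)
        then have "1 \<le> phi j q L" using denominator_pos[OF j(1)] by (simp add: phi_def le_divide_eq del: of_nat_diff)
        also have "\<dots> \<le> (\<Sum>i\<in>{j..<n}. phi i q L)"
          using j LM by (intro member_le_sum phi_nonneg) auto
        also have "\<dots> \<le> psi j q L"
          unfolding psi_def using lost_nonneg[of L] by simp
        finally have "1 \<le> psi j q L" .
        then show ?thesis unfolding q_def by (meson diff_le_0_iff_le order_trans weight_spmf_nonneg)
      next
        case False
        \<comment> \<open>\<open>card T \<le> j < n\<close> makes the failure threshold positive, so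
          passing it forces a nonempty \<open>K\<close>.\<close>
        have K: "finite K" "K \<noteq> {}"
        proof -
          show "finite K" by (simp add: K_def)
          show "K \<noteq> {}"
          proof
            assume "K = {}"
            then show False using False card_T j by simp
          qed
        qed
        have RM: "R \<subseteq> M" "R \<subseteq> base j" and LR: "L \<inter> R = {}"
          using r by (auto simp: R_def reachable_def)
        have P: "disjoint_family_on (P (Suc j)) {1..n}"
          using partition[OF j(1)] by (simp add: bundle_partition_def)
        have es: "\<And>k. k \<in> K \<Longrightarrow> distinct (es k)" "\<And>k. k \<in> K \<Longrightarrow> set (es k) \<subseteq> R"
          "\<And>k l. k \<in> K \<Longrightarrow> l \<in> K \<Longrightarrow> k \<noteq> l \<Longrightarrow> set (es k) \<inter> set (es l) = {}"
        proof -
          have *: "distinct (es k)" "set (es k) = P (Suc j) k \<inter> R" for k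
            using order[OF j(1), of "P (Suc j) k \<inter> R"] RM unfolding es_def by auto
          show "distinct (es k)" "set (es k) \<subseteq> R" for k by (auto simp: *)
          show "set (es k) \<inter> set (es l) = {}" if "k \<in> K" "l \<in> K" "k \<noteq> l" for k l
            using disjoint_family_onD[OF P, of k l] that by (auto simp: * K_def)
        qed
        have fR: "finite R" by (rule finite_subset[OF RM(1)]) simp
        note mix = K s_pos fR es
        let ?D = "mixture K s es"
        have dK: "d j \<le> 2 * card K"
        proof -
          have "real (n - card T) \<le> 2 * real (card K)" using False nT by argo
          then have "n - card T \<le> 2 * card K" by linarith
          then show ?thesis using d_le_special[OF r j(2) order.refl] by linarith
        qed
        have int: "integrable ?D f" for f :: "nat set \<Rightarrow> real"
          by (intro integrable_measure_pmf_finite finite_set_mixture[OF mix])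
        define F where "F S = weight_spmf (rba_run n gs v P \<sigma> k (Suc j) (R - S, card T, A(Suc j := S)))" for S
        have step: "1 - psi (Suc j) (Suc q) (L \<union> S) \<le> F S" if "S \<in> set_pmf ?D" for S
        proof -
          have S: "S \<subseteq> M - T - L" using set_mixture_subset[OF mix that] by (simp add: R_def)
          have eqs: "Suc j - card T = Suc q" "M - T - (L \<union> S) = R - S"
            using card_T by (auto simp: q_def R_def)
          have "1 - psi (Suc j) (Suc j - card T) (L \<union> S)
            \<le> weight_spmf (rba_run n gs v P \<sigma> k (Suc j) (M - T - (L \<union> S), card T, A(Suc j := S)))"
            by (rule Suc.IH[OF reachable_nonspecial[OF r None[unfolded R_def] S]]) (use Suc.prems in simp)
          then show ?thesis by (simp only: F_def eqs)
        qed
        have round: "rba_round n gs v P \<sigma> (Suc j) (R, card T, A) =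
          bind_spmf (spmf_of_set K) (\<lambda>k. map_spmf (\<lambda>S. (R - S, card T, A(Suc j := S)))
            (spmf_of_pmf (select_from_blocks s (es k))))"
          unfolding rba_round_eq None option.case Let_def K_def[symmetric] es_def
          by (simp only: False if_False)
        have "1 - psi j q L \<le> 1 - psi (Suc j) q L" using psi_Suc_le[OF LM j(1)] by simp
        also have "\<dots> \<le> 1 - measure_pmf.expectation ?D (\<lambda>S. psi (Suc j) (Suc q) (L \<union> S))"
          using expectation_psi_le[OF K RM(2) j(2) es dK LM LR q] by simp
        also have "\<dots> = measure_pmf.expectation ?D (\<lambda>S. 1 - psi (Suc j) (Suc q) (L \<union> S))"
          using int by simp
        also have "\<dots> \<le> measure_pmf.expectation ?D F"
          using step int by (intro integral_mono_AE) (auto simp: AE_measure_pmf_iff)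
        also have "\<dots> = weight_spmf (rba_run n gs v P \<sigma> (Suc k) j (R, card T, A))"
          unfolding rba_run.simps round weight_bind_select[OF K] F_def ..
        finally show ?thesis by (simp add: q_def R_def)
      qed
    qed
  qed
qed

lemma weight_rba_state_after_ge: "1 - psi 0 0 {} \<le> weight_spmf (rba_state_after n gs v P \<sigma> n)"
  using weight_rba_run_ge[of 0 "{}" "{}" n "\<lambda>_. {}"] rba_state_after_add[of n gs v P \<sigma> 0 n]
  by (simp add: reachable_def)

end

subsection \<open>The initial potential\<close>

lemma sum_half_powers: "(\<Sum>i<n. (1 / 2 :: real) ^ (n - i)) \<le> 1"
proof -
  have "(\<Sum>i<n. (1 / 2 :: real) ^ (n - i)) = (\<Sum>i<n. (1 / 2) ^ Suc (n - Suc i))"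
    by (intro sum.cong) (auto simp: Suc_diff_Suc)
  also have "\<dots> = (\<Sum>i<n. (1 / 2) ^ Suc i)"
    by (rule sum.nat_diff_reindex)
  also have "\<dots> = 1 - (1 / 2) ^ n" by (induction n) auto
  finally show ?thesis by simp
qed

lemma exp_minus_32_le: "exp (- 32 * real r) \<le> (1 / 2) ^ r"
proof -
  have "exp (- 1) \<le> (1 / 2 :: real)"
    using exp_ge_add_one_self[of 1] by (simp add: exp_minus field_simps)
  then have "exp (- 1) ^ r \<le> (1 / 2 :: real) ^ r" by (intro power_mono) auto
  moreover have "exp (- 32 * real r) \<le> exp (- 1) ^ r"
    by (simp add: exp_of_nat_mult[symmetric])
  ultimately show ?thesis by linarith
qed

text \<open>With \<open>c = 4 * exp rate_bound * rate_bound\<close>, an upper bound for the initial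
  exponent \<open>bet i * (2 * N)\<close>, this is the factor \<open>exp c * c\<close> in the
  resulting estimate of \<open>exp z - 1\<close>.\<close>

definition failure_const :: real where
  "failure_const = exp (4 * exp rate_bound * rate_bound) * (4 * exp rate_bound * rate_bound)"

context rba_potential
begin

text \<open>With \<open>u = min (d i) s\<close> the numerator is of order \<open>u / s\<close> and
  the denominator at least \<open>u * exp (32 * u)\<close>. If \<open>u = d i\<close>, then
  \<open>u \<ge> n - i\<close> gives geometric decay; if \<open>u = s\<close>, then
  \<open>exp (- 32 * s)\<close> is at most \<open>1 / n\<close>. Both are summable over the
  agents.\<close>

lemma phi_0_le:
  assumes i: "i < n" and s: "ln n \<le> 32 * s"
  shows "phi i 0 {} \<le> failure_const / s * ((1 / 2) ^ (n - i) + 1 / n)"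
proof -
  define u where "u = real (min (d i) s)"
  define c where "c = 4 * exp rate_bound * rate_bound"
  have c0: "0 \<le> c" by (simp add: c_def rate_bound_def)
  have u1: "1 \<le> u" "u \<le> s" using d_pos[OF i] s_pos by (auto simp: u_def)
  define z where "z = bet i * real (2 * N)"
  have "z \<le> bet i * (2 * real (d i))"
    unfolding z_def using bet_nonneg[OF i] N_le_d[OF i] by (intro mult_left_mono) auto
  also have "\<dots> = 4 * exp rate_bound * ((exp (lam i) - 1) * d i / s)" by (simp add: bet_def)
  also have "\<dots> \<le> 4 * exp rate_bound * (rate_bound * u / s)"
    using rate_le[OF i] by (intro mult_left_mono) (auto simp: u_def)
  also have "\<dots> = c * (u / s)" by (simp add: c_def)
  finally have z: "z \<le> c * (u / s)" .
  have "c * (u / s) \<le> c" using c0 u1 s_pos by (intro mult_left_le) (auto simp: field_simps)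
  with z have zc: "z \<le> c" by simp
  have z0: "0 \<le> z" using bet_nonneg[OF i] by (simp add: z_def)
  have "exp z - 1 \<le> exp z * z" by (rule exp_minus_one_le)
  also have "\<dots> \<le> exp c * (c * (u / s))" using z zc z0 by (intro mult_mono) auto
  also have "\<dots> = failure_const / s * u" by (simp add: failure_const_def c_def)
  finally have num: "exp z - 1 \<le> failure_const / s * u" .
  \<comment> \<open>The exponent \<open>lam i * d i / 8\<close> is \<open>33 * u\<close>; one
    \<open>u\<close> is spent on producing the factor that cancels the numerator.\<close>
  have "u * exp (32 * u) \<le> exp (32 * u) * (1 + u) - 1" using u1 by (simp add: algebra_simps)
  also have "exp (32 * u) * (1 + u) \<le> exp (32 * u) * exp u"
    using exp_ge_add_one_self[of u] by (intro mult_left_mono) auto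
  also have "\<dots> = exp (lam i * d i / 8)"
    using lam_d[OF i] by (simp add: u_def exp_add[symmetric] del: of_nat_min)
  finally have den: "u * exp (32 * u) \<le> exp (lam i * d i / 8) - 1" by simp
  have f0: "0 \<le> failure_const" using c0 by (simp add: failure_const_def c_def)
  have "phi i 0 {} = (exp z - 1) / (exp (lam i * d i / 8) - 1)" by (simp add: phi_def z_def)
  also have "\<dots> \<le> (failure_const / s * u) / (u * exp (32 * u))"
    using num den f0 u1 by (intro frac_le) auto
  also have "\<dots> = failure_const / s * exp (- 32 * u)" using u1 by (simp add: exp_minus divide_inverse)
  also have "\<dots> \<le> failure_const / s * ((1 / 2) ^ (n - i) + 1 / n)"
  proof (intro mult_left_mono)
    show "exp (- 32 * u) \<le> (1 / 2) ^ (n - i) + 1 / n"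
    proof (cases "d i \<le> s")
      case True
      have "n - i \<le> d i" using baseline_count_le[of gs \<theta> v i] by (simp add: d_def)
      then have "exp (- 32 * u) \<le> exp (- 32 * real (n - i))" using True by (simp add: u_def min_def del: of_nat_diff)
      also have "\<dots> \<le> (1 / 2) ^ (n - i)" by (rule exp_minus_32_le)
      also have "\<dots> \<le> (1 / 2) ^ (n - i) + 1 / n" by simp
      finally show ?thesis .
    next
      case False
      then have "exp (- 32 * u) \<le> exp (- ln n)" using s by (simp add: u_def min_def)
      also have "\<dots> = 1 / n" using i by (simp add: exp_minus inverse_eq_divide)
      finally show ?thesis by (simp add: add_increasing)
    qed
  qed (use f0 in auto)
  finally show ?thesis .
qed

lemma psi_0_le:
  assumes s: "ln n \<le> 32 * s"
  shows "psi 0 0 {} \<le> (32 + 2 * failure_const) / s"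
proof -
  have f0: "0 \<le> failure_const" by (simp add: failure_const_def rate_bound_def)
  have "(\<Sum>i\<in>{0..<n}. phi i 0 {}) \<le> (\<Sum>i<n. failure_const / s * ((1 / 2) ^ (n - i) + 1 / n))"
    unfolding atLeast0LessThan by (rule sum_mono) (simp only: lessThan_iff phi_0_le[OF _ s])
  also have "\<dots> = failure_const / s * ((\<Sum>i<n. (1 / 2) ^ (n - i)) + (\<Sum>i<n. 1 / real n))"
    by (subst sum_distrib_left[symmetric]) (simp only: sum.distrib)
  also have "\<dots> \<le> failure_const / s * (1 + 1)"
    using sum_half_powers[of n] f0 by (intro mult_left_mono add_mono) auto
  finally have "(\<Sum>i\<in>{0..<n}. phi i 0 {}) \<le> 2 * failure_const / s" by (simp add: mult.commute)
  moreover have "(lost {} + 2 / s * real (2 * N - 0)) / (N / 8) = 32 / s"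
    using N_pos by (simp add: lost_def)
  ultimately show ?thesis by (simp add: psi_def add_divide_distrib)
qed

end

subsection \<open>Value of the allocated bundles\<close>

text \<open>In a non-special round every remaining good is worth at most \<open>\<theta>\<close> and
  the chosen \<open>G\<close> at least \<open>1 / 2\<close>. By
  \<open>select_from_blocks_value\<close>, \<open>s * v i S\<close> is at least
  \<open>1 / 2 - s * \<theta>\<close>, hence at least \<open>s * \<theta>\<close>.\<close>

lemma rba_round_value:
  assumes n: "0 < ln (real n)" "0 < nat \<lfloor>ln (real n) / 16\<rfloor>" and R: "R \<subseteq> set gs"
    and x: "xos (set gs) C (v i)" and \<sigma>: "\<And>G. G \<subseteq> set gs \<Longrightarrow> supporting_order C (v i) G (\<sigma> i G)"
    and st: "st \<in> set_spmf (rba_round n gs v P \<sigma> i (R, t, A))"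
  obtains S t' where "st = (R - S, t', A(i := S))" "1 / (4 * ln (real n)) \<le> v i S"
proof (cases "find (\<lambda>e. e \<in> R \<and> v i {e} \<ge> 1 / (4 * ln (real n))) gs")
  case (Some e)
  then have "v i {e} \<ge> 1 / (4 * ln (real n))" by (auto simp: find_Some_iff)
  then show thesis using that[of "{e}" "t + 1"] st Some by (simp add: rba_round_def)
next
  case None
  define s where "s = nat \<lfloor>ln (real n) / 16\<rfloor>"
  define \<theta> where "\<theta> = 1 / (4 * ln (real n))"
  define K where "K = {k \<in> {1..n}. v i (P i k \<inter> R) \<ge> 1 / 2}"
  have round: "rba_round n gs v P \<sigma> i (R, t, A) =
      (if real (card K) < (real n - real t) / 2 then return_pmf None
       else bind_spmf (spmf_of_set K) (\<lambda>k. map_spmf (\<lambda>S. (R - S, t, A(i := S)))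
         (spmf_of_pmf (select_from_blocks s (\<sigma> i (P i k \<inter> R))))))"
    unfolding rba_round_def prod.case None option.case Let_def K_def s_def ..
  have "finite K" by (simp add: K_def)
  then have "\<exists>k\<in>K. \<exists>S\<in>set_pmf (select_from_blocks s (\<sigma> i (P i k \<inter> R))). st = (R - S, t, A(i := S))"
    using st unfolding round by (auto simp: set_bind_spmf split: if_splits)
  then obtain k S where k: "k \<in> K" and S: "S \<in> set_pmf (select_from_blocks s (\<sigma> i (P i k \<inter> R)))"
    and st': "st = (R - S, t, A(i := S))" by blast
  define G where "G = P i k \<inter> R"
  have GM: "G \<subseteq> set gs" using R by (auto simp: G_def)
  have s0: "0 < s" and \<theta>0: "0 \<le> \<theta>" using n by (auto simp: s_def \<theta>_def)
  from \<sigma>[OF GM] obtain a where a: "distinct (\<sigma> i G)" "set (\<sigma> i G) = G" "a \<in> C" "sum a G = v i G"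
    "sorted_wrt (\<lambda>x y. a x \<ge> a y) (\<sigma> i G)"
    unfolding supporting_order_def supporting_clause_def by blast
  have a0: "0 \<le> a e" if "e \<in> G" for e using x a(3) GM that unfolding xos_def by blast
  have a\<theta>: "a e \<le> \<theta>" if "e \<in> G" for e
  proof -
    have e: "e \<in> R" "e \<in> set gs" using that GM by (auto simp: G_def)
    have "a e \<le> v i {e}" using xos_clause_le[OF x _ a(3), of "{e}"] e by simp
    also have "\<dots> \<le> \<theta>" using None e by (auto simp: find_None_iff \<theta>_def)
    finally show ?thesis .
  qed
  have SG: "S \<subseteq> G"
    using select_from_blocks_subset[OF s0 a(1) S[folded G_def]] a(2) by simp
  have "sum a G - s * \<theta> \<le> s * sum a S"
    using select_from_blocks_value[OF s0 a(1) S[folded G_def] _ _ a(5) \<theta>0] a(2) a0 a\<theta> by simp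
  also have "\<dots> \<le> s * v i S"
    using xos_clause_le[OF x order.trans[OF SG GM] a(3)] by (intro mult_left_mono) auto
  finally have "1 / 2 - s * \<theta> \<le> s * v i S"
    using k a(4) by (simp add: K_def G_def)
  \<comment> \<open>Since \<open>s \<le> ln n / 16\<close>, the product \<open>s * \<theta>\<close>
    is at most \<open>1 / 64\<close>, so there is ample room.\<close>
  moreover have "2 * (s * \<theta>) \<le> 1 / 2"
  proof -
    have "real s = of_int \<lfloor>ln (real n) / 16\<rfloor>" using n(1) by (simp add: s_def)
    then have "real s \<le> ln n / 16" using of_int_floor_le[of "ln (real n) / 16"] by linarith
    then show ?thesis using n(1) by (simp add: \<theta>_def field_simps)
  qed
  ultimately have "s * \<theta> \<le> s * v i S" by linarith
  then have "\<theta> \<le> v i S" using s0 by simp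
  then show thesis using that[OF st'] by (simp add: \<theta>_def)
qed

lemma rba_state_after_value:
  assumes n: "0 < ln (real n)" "0 < nat \<lfloor>ln (real n) / 16\<rfloor>"
    and x: "\<And>i. i \<in> {1..n} \<Longrightarrow> xos (set gs) (C i) (v i)"
    and \<sigma>: "\<And>i G. i \<in> {1..n} \<Longrightarrow> G \<subseteq> set gs \<Longrightarrow> supporting_order (C i) (v i) G (\<sigma> i G)"
    and "(R, t, A) \<in> set_spmf (rba_state_after n gs v P \<sigma> i)" "i \<le> n"
  shows "R \<subseteq> set gs \<and> (\<forall>j\<in>{1..i}. 1 / (4 * ln (real n)) \<le> v j (A j))"
  using assms(5,6)
proof (induction i arbitrary: R t A)
  case (Suc i)
  then obtain R' t' A' where prev: "(R', t', A') \<in> set_spmf (rba_state_after n gs v P \<sigma> i)"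
    and step: "(R, t, A) \<in> set_spmf (rba_round n gs v P \<sigma> (Suc i) (R', t', A'))"
    by (auto simp: set_bind_spmf)
  note IH = Suc.IH[OF prev]
  have R': "R' \<subseteq> set gs" using IH Suc.prems by simp
  have i: "Suc i \<in> {1..n}" using Suc.prems by simp
  obtain S t'' where "(R, t, A) = (R' - S, t'', A'(Suc i := S))" "1 / (4 * ln (real n)) \<le> v (Suc i) S"
    using rba_round_value[OF n R' x[OF i] \<sigma>[OF i] step] by metis
  then show ?case using IH Suc.prems by (auto simp: le_Suc_eq)
qed simp

lemma rba_success_probability:
  assumes n: "32 \<le> ln (real n)" and gs: "set gs = {1..m}"
    and v: "\<And>i. i \<in> {1..n} \<Longrightarrow> xos {1..m} (C i) (v i) \<and> MMS n {1..m} (v i) = 1"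
    and P: "\<And>i. i \<in> {1..n} \<Longrightarrow> mms_partition n {1..m} (v i) (P i)"
    and \<sigma>: "\<And>i G. i \<in> {1..n} \<Longrightarrow> G \<subseteq> {1..m} \<Longrightarrow> supporting_order (C i) (v i) G (\<sigma> i G)"
  shows "1 - (32 + 2 * failure_const) * 32 / ln n
    \<le> measure (measure_spmf (random_bundle_allocation n gs v P \<sigma>))
        {A. \<forall>i\<in>{1..n}. v i (A i) \<ge> 1 / (4 * ln (real n)) * MMS n {1..m} (v i)}"
proof -
  define s where "s = nat \<lfloor>ln (real n) / 16\<rfloor>"
  define \<theta> where "\<theta> = 1 / (4 * ln (real n))"
  \<comment> \<open>Rounding down costs less than 1, which is at most half of
    \<open>ln n / 16\<close> because \<open>ln n\<close> is at least 32.\<close>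
  have s: "ln n / 32 \<le> s"
  proof -
    have "ln n / 16 < of_int \<lfloor>ln (real n) / 16\<rfloor> + 1" by linarith
    moreover have "of_int \<lfloor>ln (real n) / 16\<rfloor> \<le> real s" by (simp add: s_def)
    ultimately show ?thesis using n by linarith
  qed
  have s0: "0 < s" using s n by (auto intro: Nat.gr0I)
  \<comment> \<open>Bundles the conclusions of \<open>xos_bundle_weights\<close> into one predicate,
    so that weights for all agents can be chosen simultaneously.\<close>
  define good where "good i w \<longleftrightarrow> (\<forall>e\<in>set gs. 0 \<le> w e \<and> w e \<le> 1) \<and>
      sum w (set gs) = real (n - baseline_count gs \<theta> v i) \<and>
      (\<forall>T L. T \<subseteq> set gs \<longrightarrow> L \<subseteq> set gs \<longrightarrow>
        real (n - baseline_count gs \<theta> v i) - card (T - (set gs - special_baseline gs \<theta> v i)) - 2 * sum w L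
        \<le> card {k\<in>{1..n}. 1 / 2 \<le> v (Suc i) (P (Suc i) k \<inter> (set gs - T - L))})"
    for i and w :: "nat \<Rightarrow> real"
  have "\<exists>w. good i w"
    if i: "i < n" for i
  proof -
    have i': "Suc i \<in> {1..n}" using i by simp
    have part: "bundle_partition n (set gs) (P (Suc i))"
      and min: "Min ((\<lambda>k. v (Suc i) (P (Suc i) k)) ` {1..n}) = 1"
      using P[OF i'] v[OF i'] gs by (auto simp: mms_partition_def)
    have v1: "1 \<le> v (Suc i) (P (Suc i) k)" if "k \<in> {1..n}" for k
      unfolding min[symmetric] using that by (intro Min_le) auto
    have x: "xos (set gs) (C (Suc i)) (v (Suc i))" using v[OF i'] gs by simp
    have c: "card (set gs - special_baseline gs \<theta> v i) \<le> n"
      using baseline_count_le[of gs \<theta> v i] i by (simp add: baseline_count_def)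
    obtain w :: "nat \<Rightarrow> real" where "\<And>e. e \<in> set gs \<Longrightarrow> 0 \<le> w e" "\<And>e. e \<in> set gs \<Longrightarrow> w e \<le> 1"
      "sum w (set gs) = real (n - baseline_count gs \<theta> v i)"
      "\<And>T L. T \<subseteq> set gs \<Longrightarrow> L \<subseteq> set gs \<Longrightarrow>
        real (n - baseline_count gs \<theta> v i) - card (T - (set gs - special_baseline gs \<theta> v i)) - 2 * sum w L
        \<le> card {k\<in>{1..n}. 1 / 2 \<le> v (Suc i) (P (Suc i) k \<inter> (set gs - T - L))}"
      using xos_bundle_weights[OF part x _ v1 Diff_subset c, folded baseline_count_def] by blast
    then have "good i w" unfolding good_def by blast
    then show ?thesis by (rule exI[where x=w])
  qed
  then have "\<forall>i. \<exists>w. i < n \<longrightarrow> good i w" by blast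
  from choice[OF this] obtain w where "\<And>i. i < n \<Longrightarrow> good i (w i)" by blast
  note w = this[unfolded good_def]
  interpret rba_potential n gs v P \<sigma> \<theta> s w
  proof
    show "bundle_partition n (set gs) (P (Suc i))" if "i < n" for i
      using P[of "Suc i"] that gs by (auto simp: mms_partition_def)
    show "distinct (\<sigma> (Suc i) G) \<and> set (\<sigma> (Suc i) G) = G" if "i < n" "G \<subseteq> set gs" for i G
      using \<sigma>[of "Suc i" G] that gs by (auto simp: supporting_order_def)
  qed (use w s0 in \<open>auto simp: s_def \<theta>_def\<close>)
  let ?p = "random_bundle_allocation n gs v P \<sigma>"
  have "psi 0 0 {} \<le> (32 + 2 * failure_const) / s" using s by (intro psi_0_le) simp
  also have "\<dots> \<le> (32 + 2 * failure_const) / (ln n / 32)"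
    using s n by (intro divide_left_mono) (auto simp: failure_const_def rate_bound_def)
  finally have "1 - (32 + 2 * failure_const) * 32 / ln n \<le> weight_spmf ?p"
    using weight_rba_state_after_ge by (simp add: random_bundle_allocation_def)
  also have "\<dots> \<le> measure (measure_spmf ?p)
      {A. \<forall>i\<in>{1..n}. v i (A i) \<ge> 1 / (4 * ln (real n)) * MMS n {1..m} (v i)}"
  \<comment> \<open>The weight is the mass of all outcomes without failure, and in each of them
    every agent meets the threshold.\<close>
  proof (rule measure_spmf.finite_measure_mono_AE)
    have "1 / (4 * ln (real n)) * MMS n {1..m} (v i) \<le> v i (A i)"
      if "(R, t, A) \<in> set_spmf (rba_state_after n gs v P \<sigma> n)" "i \<in> {1..n}" for R t A i
      using rba_state_after_value[of n gs C v \<sigma> R t A P n] that n s0 v[OF that(2)] v \<sigma> gs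
      by (simp add: s_def)
    then show "AE A in measure_spmf ?p. A \<in> space (measure_spmf ?p) \<longrightarrow>
        A \<in> {A. \<forall>i\<in>{1..n}. v i (A i) \<ge> 1 / (4 * ln (real n)) * MMS n {1..m} (v i)}"
      by (auto simp: random_bundle_allocation_def)
  qed auto
  finally show ?thesis .
qed

theorem theorem7p9:
  shows "\<exists>f :: nat \<Rightarrow> real. f \<in> O(\<lambda>n. 1 / ln (real n)) \<and>
    (\<forall>\<^sub>F n in sequentially.
      \<forall>(m :: nat) (v :: nat \<Rightarrow> nat set \<Rightarrow> real) (C :: nat \<Rightarrow> (nat \<Rightarrow> real) set)
        (gs :: nat list) (P :: nat \<Rightarrow> nat \<Rightarrow> nat set) (\<sigma> :: nat \<Rightarrow> nat set \<Rightarrow> nat list).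
        (\<forall>i\<in>{1..n}. valuation {1..m} (v i) \<and> xos {1..m} (C i) (v i) \<and> MMS n {1..m} (v i) = 1) \<longrightarrow>
        distinct gs \<and> set gs = {1..m} \<longrightarrow>
        (\<forall>i\<in>{1..n}. mms_partition n {1..m} (v i) (P i)) \<longrightarrow>
        (\<forall>i\<in>{1..n}. \<forall>G\<subseteq>{1..m}. supporting_order (C i) (v i) G (\<sigma> i G)) \<longrightarrow>
        measure (measure_spmf (random_bundle_allocation n gs v P \<sigma>))
          {A. \<forall>i\<in>{1..n}. v i (A i) \<ge> 1 / (4 * ln (real n)) * MMS n {1..m} (v i)}
          \<ge> 1 - f n)"
proof (intro exI conjI)
  let ?f = "\<lambda>n. (32 + 2 * failure_const) * 32 / ln (real n)"
  have "(\<lambda>n. (32 + 2 * failure_const) * 32 * (1 / ln (real n))) \<in> O(\<lambda>n. 1 / ln (real n))"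
    by (intro bigoI[of _ "\<bar>(32 + 2 * failure_const) * 32\<bar>"]) (simp add: abs_mult)
  then show "?f \<in> O(\<lambda>n. 1 / ln (real n))" by simp
  have "filterlim (\<lambda>n. ln (real n)) at_top sequentially"
    by (rule filterlim_compose[OF ln_at_top filterlim_real_sequentially])
  then have "\<forall>\<^sub>F n in sequentially. 32 \<le> ln (real n)" by (simp add: filterlim_at_top)
  then show "\<forall>\<^sub>F n in sequentially.
      \<forall>(m :: nat) (v :: nat \<Rightarrow> nat set \<Rightarrow> real) (C :: nat \<Rightarrow> (nat \<Rightarrow> real) set)
        (gs :: nat list) (P :: nat \<Rightarrow> nat \<Rightarrow> nat set) (\<sigma> :: nat \<Rightarrow> nat set \<Rightarrow> nat list).
        (\<forall>i\<in>{1..n}. valuation {1..m} (v i) \<and> xos {1..m} (C i) (v i) \<and> MMS n {1..m} (v i) = 1) \<longrightarrow>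
        distinct gs \<and> set gs = {1..m} \<longrightarrow>
        (\<forall>i\<in>{1..n}. mms_partition n {1..m} (v i) (P i)) \<longrightarrow>
        (\<forall>i\<in>{1..n}. \<forall>G\<subseteq>{1..m}. supporting_order (C i) (v i) G (\<sigma> i G)) \<longrightarrow>
        measure (measure_spmf (random_bundle_allocation n gs v P \<sigma>))
          {A. \<forall>i\<in>{1..n}. v i (A i) \<ge> 1 / (4 * ln (real n)) * MMS n {1..m} (v i)}
          \<ge> 1 - ?f n"
    by (rule eventually_mono) (intro allI impI rba_success_probability; blast)
qed

end
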